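(* Let $C\in[0,C^\star(\mathcal R)]$. The function $p_{\mathrm{right}}$ defined below is an optimal solution of the right problem, and the optimal objective value of the right problem is $$R_{\mathrm{right}}=\min\big\{\mathrm{CP}_o(p_{\mathrm{right}}(\bar x);(\bar x,0)),\ \mathrm{CP}_u(p_{\mathrm{right}}(\bar x);(\max\{m,\bar x\},m))\big\}.$$ Here $p_{\mathrm{right}}(\bar x)=\arg\min_{p\in[\widetilde l(\bar x;C),u(\bar x;C)]}|p-\underline g(\bar x)|$, and for $x\in(\bar x,\max\{m,\bar x\}]$: $p_{\mathrm{right}}(x)=\max\{-x+\bar x+p_{\mathrm{right}}(\bar x),\underline g(x)\}$ if $p_{\mathrm{right}}(\bar x)\in[\underline g(\bar x),\bar g(\bar x)]$; $p_{\mathrm{right}}(x)=\underline g(x;R_{\mathrm{right}})$ if $p_{\mathrm{right}}(\bar x)<\underline g(\bar x)$; $p_{\mathrm{right}}(x)=\bar g(x;R_{\mathrm{right}})$ if $p_{\mathrm{right}}(\bar x)>\bar g(\bar x)$ (with $R_{\mathrm{right}}$ given by the displayed formula).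
   Context: Setting. A firm holds $m>0$ units of a divisible resource; low- and high-reward requests yield per-unit rewards $r_\ell,r_h$ with $0<r_\ell<r_h$. ML advice: a convex set $\mathcal R\subset\mathbb R^2$ of demand vectors $(x,y)$ ($x$ total low-reward demand, $y$ total high-reward demand). $C^\star(\mathcal R)$ is the largest consistent ratio (worst-case ratio of expected reward to the clairvoyant optimum $\min\{y,m\}r_h+\min\{x,(m-y)^+\}r_\ell$ over arrival sequences with demand vector in $\mathcal R$) achievable by any online algorithm. $\rho=\frac{1}{2-r_\ell/r_h}$. Region notation: $\underline x=\inf_{(x,y)\in\mathcal R}x$, $\bar x=\sup_{(x,y)\in\mathcal R}x$; for $x\in[\underline x,\bar x]$, $\bar h(x)=\sup\{y:(x,y)\in\mathcal R\}$, $\underline h(x)=\inf\{y:(x,y)\in\mathcal R\}$; $\underline{\mathcal H}(x)=\min\{\underline h(x),m\}$; $\overline{\mathcal R}=\{(x,y)\in\mathcal R:y=\sup_{(x',y')\in\mathcal R}\min\{y',m\}\}$, $\underline{\mathcal R}=\{(x,y)\in\mathcal R:y=\inf_{(x',y')\in\mathcal R}\min\{y',m\}\}$; $L=(x_L,y_L)$ is the point of $\underline{\mathcal R}$ with smallest first coordinate, $H=(x_H,y_H)$ the point of $\overline{\mathcal R}$ with largest first coordinate. Compatible ratios for $p\in[0,m]$, $x,y\ge0$: $\mathrm{CP}_o(p;(x,y))=\frac{\min\{y,m\}r_h+\min\{x,(m-p)^+\}r_\ell}{\min\{y,m\}r_h+\min\{x,(m-y)^+\}r_\ell}$, $\mathrm{CP}_u(p;(x,y))=\frac{\max\{p,\min\{y,(m-x)^+\}\}r_h+\min\{x,m-p\}r_\ell}{\min\{y,m\}r_h+\min\{x,(m-y)^+\}r_\ell}$.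 Upper bound $u(\cdot;C)$: $\bar x_u=x_L$ if $x_L+y_L\ge m$, else $\bar x_u=\sup\{x\in[x_L,\bar x]:(1-C)\frac{r_h}{r_\ell}\underline{\mathcal H}'(x^-)-C<0\}$; $\underline x_u=\sup\{x\in(\underline x,\bar x_u):\mathrm{CP}_o(m;(x,\underline h(x)))\ge C\}$ ($=\underline x$ if empty); $u(x;C)=\sup\{p\in[0,m]:\mathrm{CP}_o(p;(x,\underline h(x)))=C\}$ on $[\underline x_u,\bar x_u]$, $u(x;C)=m$ on $[0,\underline x_u]$, $u(x;C)=u(\bar x_u;C)$ on $[\bar x_u,\bar x]$. Lower bound: $\bar x_l=\inf\{x\in(x_H,\bar x):\mathrm{CP}_u(0;(x,\bar h(x)))\ge C\}$ ($=\bar x$ if empty); $l(x;C)=\inf\{p\in[0,m]:\mathrm{CP}_u(p;(x,\bar h(x)))=C\}$ on $[x_H,\bar x_l]$, $l(x;C)=l(x_H;C)$ on $[0,x_H]$, $l(x;C)=0$ on $[\bar x_l,\bar x]$. With $x_{-1}=\sup\{x\in[x_H,\bar x]:\partial_x l(x^-;C)\le-1\}$ (set to $\bar x$ when $\partial_x l(x^-;C)\ge-1$ on all of $[x_H,\bar x]$): $\widetilde l(x;C)=l(x;C)$ on $[0,x_{-1}]$ and $\widetilde l(x;C)=(l(x_{-1};C)-(x-x_{-1}))^+$ on $[x_{-1},\bar x]$. Robustness bounds: for $R\in[0,\rho]$ and $x\in[0,m]$, $\underline g(x;R)=\frac{m(R-r_\ell/r_h)}{1-r_\ell/r_h}$,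 $\bar g(x;R)=-Rx+m$; for $x>m$ their values at $m$. $\underline g(x)=\underline g(x;\rho)=\frac{1-r_\ell/r_h}{2-r_\ell/r_h}m$, $\bar g(x)=\bar g(x;\rho)$. Right problem: maximize $R$ over $R\in[0,\rho]$ and $p:[\bar x,\max\{m,\bar x\}]\to\mathbb R$ subject to $\widetilde l(\bar x;C)\le p(\bar x)\le u(\bar x;C)$; $\underline g(x;R)\le p(x)\le\bar g(x;R)$ for $x\in[\bar x,\max\{m,\bar x\}]$; $p\ge0$ continuous and $-1\le p'\le0$ a.e. on $[\bar x,\max\{m,\bar x\}]$. (If $\bar x\ge m$ only the value $p(\bar x)$ is optimized.)
   Formalization: The optimal value is proved to be min{ρ, R_right}; the stated value R_right exceeds ρ, hence is impossible, when p_right(x̄) lies strictly between g_(x̄) and ḡ(x̄), and is proved in all other cases. The region is taken bounded with closed x-projection so that x̄ and h̄ are defined. *)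

theory Defs
  imports "HOL-Probability.Probability"
begin

section \<open>Requests, online algorithms and the largest consistent ratio\<close>

text \<open>A request is a (divisible) amount of low- or high-reward demand.\<close>

datatype request = Low (amount: real) | High (amount: real)

fun unit_reward :: "real \<Rightarrow> real \<Rightarrow> request \<Rightarrow> real" where
  "unit_reward rl rh (Low q) = rl"
| "unit_reward rl rh (High q) = rh"

fun low_amount :: "request \<Rightarrow> real" where
  "low_amount (Low q) = q"
| "low_amount (High q) = 0"

fun high_amount :: "request \<Rightarrow> real" where
  "high_amount (Low q) = 0"
| "high_amount (High q) = q"

definition valid_seq :: "request list \<Rightarrow> bool" where
  "valid_seq \<sigma> \<longleftrightarrow> (\<forall>r\<in>set \<sigma>. 0 \<le> amount r)"

definition demand :: "request list \<Rightarrow> real \<times> real" where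
  "demand \<sigma> = ((\<Sum>r\<leftarrow>\<sigma>. low_amount r), (\<Sum>r\<leftarrow>\<sigma>. high_amount r))"

definition clairvoyant :: "real \<Rightarrow> real \<Rightarrow> real \<Rightarrow> real \<Rightarrow> real \<Rightarrow> real" where
  "clairvoyant m rl rh x y = min y m * rh + min x (max (m - y) 0) * rl"

text \<open>A ratio to the clairvoyant optimum; it is 1 if that optimum is 0, i.e. if there is no demand.\<close>

definition ratio_to_opt :: "real \<Rightarrow> real \<Rightarrow> real" where
  "ratio_to_opt rew opt = (if opt = 0 then 1 else rew / opt)"

text \<open>
  A (randomized) online algorithm draws a seed \<open>\<omega>\<close> from a probability space \<open>M\<close>; \<open>A \<omega> \<tau>\<close> is the
  amount it accepts of the last request of \<open>\<tau>\<close> after having seen exactly the requests in \<open>\<tau>\<close>.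
\<close>

type_synonym algorithm = "real \<Rightarrow> request list \<Rightarrow> real"

definition online_algorithm :: "real \<Rightarrow> real measure \<Rightarrow> algorithm \<Rightarrow> bool" where
  "online_algorithm m M A \<longleftrightarrow>
     prob_space M \<and>
     (\<forall>\<tau>. (\<lambda>\<omega>. A \<omega> \<tau>) \<in> borel_measurable M) \<and>
     (\<forall>\<omega>\<in>space M. \<forall>\<sigma>. valid_seq \<sigma> \<longrightarrow>
        (\<forall>i<length \<sigma>. 0 \<le> A \<omega> (take (Suc i) \<sigma>) \<and> A \<omega> (take (Suc i) \<sigma>) \<le> amount (\<sigma> ! i)) \<and>
        (\<Sum>i<length \<sigma>. A \<omega> (take (Suc i) \<sigma>)) \<le> m)"

definition expected_reward ::
  "real \<Rightarrow> real \<Rightarrow> real measure \<Rightarrow> algorithm \<Rightarrow> request list \<Rightarrow> real" where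
  "expected_reward rl rh M A \<sigma> =
     (LINT \<omega>|M. (\<Sum>i<length \<sigma>. unit_reward rl rh (\<sigma> ! i) * A \<omega> (take (Suc i) \<sigma>)))"

definition consistent_ratio ::
  "real \<Rightarrow> real \<Rightarrow> real \<Rightarrow> (real \<times> real) set \<Rightarrow> real measure \<Rightarrow> algorithm \<Rightarrow> real" where
  "consistent_ratio m rl rh \<R> M A =
     (INF \<sigma>\<in>{\<sigma>. valid_seq \<sigma> \<and> demand \<sigma> \<in> \<R>}.
        ratio_to_opt (expected_reward rl rh M A \<sigma>)
          (clairvoyant m rl rh (fst (demand \<sigma>)) (snd (demand \<sigma>))))"

definition C_star :: "real \<Rightarrow> real \<Rightarrow> real \<Rightarrow> (real \<times> real) set \<Rightarrow> real" where
  "C_star m rl rh \<R> = Sup {consistent_ratio m rl rh \<R> M A | M A. online_algorithm m M A}"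

section \<open>The advice region\<close>

definition x_lo :: "(real \<times> real) set \<Rightarrow> real" where
  "x_lo \<R> = (INF q\<in>\<R>. fst q)"

definition x_hi :: "(real \<times> real) set \<Rightarrow> real" where
  "x_hi \<R> = (SUP q\<in>\<R>. fst q)"

text \<open>The next two are meaningful only for \<open>x\<close> in the projection of \<open>\<R>\<close>.\<close>

definition h_hi :: "(real \<times> real) set \<Rightarrow> real \<Rightarrow> real" where
  "h_hi \<R> x = Sup {y. (x, y) \<in> \<R>}"

definition h_lo :: "(real \<times> real) set \<Rightarrow> real \<Rightarrow> real" where
  "h_lo \<R> x = Inf {y. (x, y) \<in> \<R>}"

definition H_lo :: "real \<Rightarrow> (real \<times> real) set \<Rightarrow> real \<Rightarrow> real" where
  "H_lo m \<R> x = min (h_lo \<R> x) m"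

definition region_top :: "real \<Rightarrow> (real \<times> real) set \<Rightarrow> (real \<times> real) set" where
  "region_top m \<R> = {q \<in> \<R>. snd q = (SUP q'\<in>\<R>. min (snd q') m)}"

definition region_bot :: "real \<Rightarrow> (real \<times> real) set \<Rightarrow> (real \<times> real) set" where
  "region_bot m \<R> = {q \<in> \<R>. snd q = (INF q'\<in>\<R>. min (snd q') m)}"

definition is_L :: "real \<Rightarrow> (real \<times> real) set \<Rightarrow> real \<times> real \<Rightarrow> bool" where
  "is_L m \<R> L \<longleftrightarrow> L \<in> region_bot m \<R> \<and> (\<forall>q\<in>region_bot m \<R>. fst L \<le> fst q)"

definition is_H :: "real \<Rightarrow> (real \<times> real) set \<Rightarrow> real \<times> real \<Rightarrow> bool" where
  "is_H m \<R> H \<longleftrightarrow> H \<in> region_top m \<R> \<and> (\<forall>q\<in>region_top m \<R>. fst q \<le> fst H)"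

section \<open>Compatible ratios\<close>

definition CP_o :: "real \<Rightarrow> real \<Rightarrow> real \<Rightarrow> real \<Rightarrow> real \<Rightarrow> real \<Rightarrow> real" where
  "CP_o m rl rh p x y =
     ratio_to_opt (min y m * rh + min x (max (m - p) 0) * rl) (clairvoyant m rl rh x y)"

definition CP_u :: "real \<Rightarrow> real \<Rightarrow> real \<Rightarrow> real \<Rightarrow> real \<Rightarrow> real \<Rightarrow> real" where
  "CP_u m rl rh p x y =
     ratio_to_opt (max p (min y (max (m - x) 0)) * rh + min x (m - p) * rl) (clairvoyant m rl rh x y)"

section \<open>Upper and lower bounds on the protection level\<close>

text \<open>
  The left derivative is taken in the extended reals, so that a vertical tangent or a jump has
  derivative \<open>\<plusminus>\<infinity>\<close>.
\<close>

definition left_deriv :: "(real \<Rightarrow> real) \<Rightarrow> real \<Rightarrow> ereal" where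
  "left_deriv f x = Lim (at_left x) (\<lambda>z. ereal ((f x - f z) / (x - z)))"

text \<open>
  Inserting \<open>fst L\<close> fixes the supremum to be \<open>fst L\<close> if the set is empty and makes the value of the
  left derivative at \<open>fst L\<close> irrelevant (it is meaningless if \<open>fst L = x_lo \<R>\<close>).
\<close>

definition xu_hi ::
  "real \<Rightarrow> real \<Rightarrow> real \<Rightarrow> (real \<times> real) set \<Rightarrow> real \<times> real \<Rightarrow> real \<Rightarrow> real" where
  "xu_hi m rl rh \<R> L C =
     (if fst L + snd L \<ge> m then fst L
      else Sup (insert (fst L)
             {x \<in> {fst L..x_hi \<R>}.
                ereal ((1 - C) * (rh / rl)) * left_deriv (H_lo m \<R>) x - ereal C < 0}))"

definition xu_lo ::
  "real \<Rightarrow> real \<Rightarrow> real \<Rightarrow> (real \<times> real) set \<Rightarrow> real \<times> real \<Rightarrow> real \<Rightarrow> real" where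
  "xu_lo m rl rh \<R> L C =
     (let S = {x \<in> {x_lo \<R><..<xu_hi m rl rh \<R> L C}. CP_o m rl rh m x (h_lo \<R> x) \<ge> C}
      in if S = {} then x_lo \<R> else Sup S)"

text \<open>
  \<open>CP_o\<close> is nonincreasing in \<open>p\<close> and at least 1 at \<open>p = 0\<close>, so for \<open>C \<le> 1\<close> no \<open>p\<close> attains \<open>C\<close> only
  if every \<open>p\<close> has ratio above \<open>C\<close>; the bound is then vacuous, i.e. \<open>m\<close>.
\<close>

definition u_solve :: "real \<Rightarrow> real \<Rightarrow> real \<Rightarrow> (real \<times> real) set \<Rightarrow> real \<Rightarrow> real \<Rightarrow> real" where
  "u_solve m rl rh \<R> C x =
     (let S = {p \<in> {0..m}. CP_o m rl rh p x (h_lo \<R> x) = C} in if S = {} then m else Sup S)"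

definition u_bound ::
  "real \<Rightarrow> real \<Rightarrow> real \<Rightarrow> (real \<times> real) set \<Rightarrow> real \<times> real \<Rightarrow> real \<Rightarrow> real \<Rightarrow> real" where
  "u_bound m rl rh \<R> L C x =
     (if x < xu_lo m rl rh \<R> L C then m
      else if x \<le> xu_hi m rl rh \<R> L C then u_solve m rl rh \<R> C x
      else u_solve m rl rh \<R> C (xu_hi m rl rh \<R> L C))"

definition xl_hi ::
  "real \<Rightarrow> real \<Rightarrow> real \<Rightarrow> (real \<times> real) set \<Rightarrow> real \<times> real \<Rightarrow> real \<Rightarrow> real" where
  "xl_hi m rl rh \<R> H C =
     (let S = {x \<in> {fst H<..<x_hi \<R>}. CP_u m rl rh 0 x (h_hi \<R> x) \<ge> C}
      in if S = {} then x_hi \<R> else Inf S)"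

text \<open>
  Dually, \<open>CP_u\<close> is nondecreasing in \<open>p\<close> and at least 1 at \<open>p = m\<close>; the bound is vacuous, i.e. 0,
  if no \<open>p\<close> attains \<open>C\<close>.
\<close>

definition l_solve :: "real \<Rightarrow> real \<Rightarrow> real \<Rightarrow> (real \<times> real) set \<Rightarrow> real \<Rightarrow> real \<Rightarrow> real" where
  "l_solve m rl rh \<R> C x =
     (let S = {p \<in> {0..m}. CP_u m rl rh p x (h_hi \<R> x) = C} in if S = {} then 0 else Inf S)"

definition l_bound ::
  "real \<Rightarrow> real \<Rightarrow> real \<Rightarrow> (real \<times> real) set \<Rightarrow> real \<times> real \<Rightarrow> real \<Rightarrow> real \<Rightarrow> real" where
  "l_bound m rl rh \<R> H C x =
     (if x < fst H then l_solve m rl rh \<R> C (fst H)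
      else if x \<le> xl_hi m rl rh \<R> H C then l_solve m rl rh \<R> C x
      else 0)"

definition x_minus1 ::
  "real \<Rightarrow> real \<Rightarrow> real \<Rightarrow> (real \<times> real) set \<Rightarrow> real \<times> real \<Rightarrow> real \<Rightarrow> real" where
  "x_minus1 m rl rh \<R> H C =
     (if \<forall>x\<in>{fst H..x_hi \<R>}. left_deriv (l_bound m rl rh \<R> H C) x \<ge> -1 then x_hi \<R>
      else Sup {x \<in> {fst H..x_hi \<R>}. left_deriv (l_bound m rl rh \<R> H C) x \<le> -1})"

definition l_tilde ::
  "real \<Rightarrow> real \<Rightarrow> real \<Rightarrow> (real \<times> real) set \<Rightarrow> real \<times> real \<Rightarrow> real \<Rightarrow> real \<Rightarrow> real" where
  "l_tilde m rl rh \<R> H C x =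
     (let x1 = x_minus1 m rl rh \<R> H C
      in if x \<le> x1 then l_bound m rl rh \<R> H C x
         else max (l_bound m rl rh \<R> H C x1 - (x - x1)) 0)"

section \<open>Robustness bounds and the right problem\<close>

definition \<rho> :: "real \<Rightarrow> real \<Rightarrow> real" where
  "\<rho> rl rh = 1 / (2 - rl / rh)"

definition g_lo :: "real \<Rightarrow> real \<Rightarrow> real \<Rightarrow> real \<Rightarrow> real \<Rightarrow> real" where
  "g_lo m rl rh R x = m * (R - rl / rh) / (1 - rl / rh)"

definition g_hi :: "real \<Rightarrow> real \<Rightarrow> real \<Rightarrow> real" where
  "g_hi m R x = - R * min x m + m"

definition right_feasible ::
  "real \<Rightarrow> real \<Rightarrow> real \<Rightarrow> (real \<times> real) set \<Rightarrow> real \<times> real \<Rightarrow> real \<times> real \<Rightarrow> real \<Rightarrow>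
   real \<Rightarrow> (real \<Rightarrow> real) \<Rightarrow> bool" where
  "right_feasible m rl rh \<R> L H C R p \<longleftrightarrow>
     (let a = x_hi \<R>; I = {a..max m a} in
        0 \<le> R \<and> R \<le> \<rho> rl rh \<and>
        l_tilde m rl rh \<R> H C a \<le> p a \<and> p a \<le> u_bound m rl rh \<R> L C a \<and>
        (\<forall>x\<in>I. g_lo m rl rh R x \<le> p x \<and> p x \<le> g_hi m R x) \<and>
        (\<forall>x\<in>I. 0 \<le> p x) \<and> continuous_on I p \<and>
        (AE x in lborel. x \<in> I \<longrightarrow>
           (\<exists>d. (p has_real_derivative d) (at x within I) \<and> -1 \<le> d \<and> d \<le> 0)))"

definition right_optimal ::
  "real \<Rightarrow> real \<Rightarrow> real \<Rightarrow> (real \<times> real) set \<Rightarrow> real \<times> real \<Rightarrow> real \<times> real \<Rightarrow> real \<Rightarrow>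
   real \<Rightarrow> (real \<Rightarrow> real) \<Rightarrow> bool" where
  "right_optimal m rl rh \<R> L H C R p \<longleftrightarrow>
     right_feasible m rl rh \<R> L H C R p \<and>
     (\<forall>R' p'. right_feasible m rl rh \<R> L H C R' p' \<longrightarrow> R' \<le> R)"

definition right_value ::
  "real \<Rightarrow> real \<Rightarrow> real \<Rightarrow> (real \<times> real) set \<Rightarrow> real \<times> real \<Rightarrow> real \<times> real \<Rightarrow> real \<Rightarrow> real" where
  "right_value m rl rh \<R> L H C = Sup {R. \<exists>p. right_feasible m rl rh \<R> L H C R p}"

definition p_right_start ::
  "real \<Rightarrow> real \<Rightarrow> real \<Rightarrow> (real \<times> real) set \<Rightarrow> real \<times> real \<Rightarrow> real \<times> real \<Rightarrow> real \<Rightarrow> real" where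
  "p_right_start m rl rh \<R> L H C =
     (ARG_MIN (\<lambda>p. \<bar>p - g_lo m rl rh (\<rho> rl rh) (x_hi \<R>)\<bar>) p.
        p \<in> {l_tilde m rl rh \<R> H C (x_hi \<R>)..u_bound m rl rh \<R> L C (x_hi \<R>)})"

text \<open>
  If \<open>p_right_start\<close> lies strictly between the two robustness bounds at \<open>x_hi \<R>\<close>, both ratios below
  exceed \<open>\<rho>\<close>, whereas \<open>R \<le> \<rho>\<close> is a constraint of the right problem; in all other cases the minimum is
  at most \<open>\<rho>\<close>. So the optimal value is the minimum truncated at \<open>\<rho>\<close>.
\<close>

definition R_right ::
  "real \<Rightarrow> real \<Rightarrow> real \<Rightarrow> (real \<times> real) set \<Rightarrow> real \<times> real \<Rightarrow> real \<times> real \<Rightarrow> real \<Rightarrow> real" where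
  "R_right m rl rh \<R> L H C =
     min (CP_o m rl rh (p_right_start m rl rh \<R> L H C) (x_hi \<R>) 0)
         (CP_u m rl rh (p_right_start m rl rh \<R> L H C) (max m (x_hi \<R>)) m)"

definition p_right ::
  "real \<Rightarrow> real \<Rightarrow> real \<Rightarrow> (real \<times> real) set \<Rightarrow> real \<times> real \<Rightarrow> real \<times> real \<Rightarrow> real \<Rightarrow> real \<Rightarrow> real" where
  "p_right m rl rh \<R> L H C x =
     (let a = x_hi \<R>; p0 = p_right_start m rl rh \<R> L H C in
        if x \<le> a then p0
        else if p0 < g_lo m rl rh (\<rho> rl rh) a then g_lo m rl rh (R_right m rl rh \<R> L H C) x
        else if p0 > g_hi m (\<rho> rl rh) a then g_hi m (R_right m rl rh \<R> L H C) x
        else max (- x + a + p0) (g_lo m rl rh (\<rho> rl rh) x))"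

end

theory Submission
  imports Defs
begin

text \<open>
  The real content is that the interval from which the start value is chosen is nonempty. Feed an
  algorithm of consistent ratio \<open>c\<close> with low demand first: the capacity it is expected to have left is
  a protection level that is nonincreasing in the low demand, with slope at least \<open>-1\<close>, and that lies
  above the lower and below the upper bound for \<open>c\<close>. Only two of its values matter, one at
  \<open>x_minus1\<close> and one at \<open>xu_hi\<close>; compactness turns \<open>c\<close> arbitrarily close to \<open>C\<close> into \<open>C\<close>.
  The start value is then the projection of the constant lower robustness bound for \<open>\<rho>\<close> to that
  interval. At each fixed point, one robustness bound is equivalent to \<open>R \<le> CP_o\<close> and the other to
  \<open>R \<le> CP_u\<close>, so if the projection misses the robust range, the violated bound at the right end of
  the region limits \<open>R\<close>, and following that bound attains the limit.
\<close>

section \<open>Expected rewards of online algorithms\<close>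

definition expected_accepted :: "real measure \<Rightarrow> algorithm \<Rightarrow> request list \<Rightarrow> real" where
  "expected_accepted M A \<sigma> = (LINT \<omega>|M. (\<Sum>i<length \<sigma>. A \<omega> (take (Suc i) \<sigma>)))"

lemma online_algorithm_bounds:
  assumes "online_algorithm m M A" "valid_seq \<sigma>" "\<omega> \<in> space M"
  shows "i < length \<sigma> \<Longrightarrow> 0 \<le> A \<omega> (take (Suc i) \<sigma>)"
    and "i < length \<sigma> \<Longrightarrow> A \<omega> (take (Suc i) \<sigma>) \<le> amount (\<sigma> ! i)"
    and "(\<Sum>i<length \<sigma>. A \<omega> (take (Suc i) \<sigma>)) \<le> m"
  using assms unfolding online_algorithm_def by blast+

lemma integrable_accepted:
  assumes "online_algorithm m M A" "valid_seq \<sigma>" "i < length \<sigma>"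
  shows "integrable M (\<lambda>\<omega>. A \<omega> (take (Suc i) \<sigma>))"
proof -
  interpret prob_space M using assms(1) by (simp add: online_algorithm_def)
  show ?thesis
  proof (rule integrable_const_bound)
    show "AE \<omega> in M. norm (A \<omega> (take (Suc i) \<sigma>)) \<le> amount (\<sigma> ! i)"
      using online_algorithm_bounds[OF assms(1,2)] assms(3) by (intro AE_I2) auto
  qed (use assms(1) in \<open>simp add: online_algorithm_def\<close>)
qed

lemma expected_accepted_bounds:
  assumes "online_algorithm m M A" "valid_seq \<sigma>"
  shows "0 \<le> expected_accepted M A \<sigma>" "expected_accepted M A \<sigma> \<le> m"
    "expected_accepted M A \<sigma> \<le> (\<Sum>i<length \<sigma>. amount (\<sigma> ! i))"
proof -
  interpret prob_space M using assms(1) by (simp add: online_algorithm_def)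
  have int: "integrable M (\<lambda>\<omega>. \<Sum>i<length \<sigma>. A \<omega> (take (Suc i) \<sigma>))"
    using integrable_accepted[OF assms] by auto
  note bds = online_algorithm_bounds[OF assms]
  show "0 \<le> expected_accepted M A \<sigma>"
    unfolding expected_accepted_def
    by (intro integral_ge_const int AE_I2 sum_nonneg) (use bds(1) in auto)
  show "expected_accepted M A \<sigma> \<le> m"
    unfolding expected_accepted_def
    by (intro integral_le_const int AE_I2 bds(3))
  show "expected_accepted M A \<sigma> \<le> (\<Sum>i<length \<sigma>. amount (\<sigma> ! i))"
    unfolding expected_accepted_def
    by (intro integral_le_const int AE_I2 sum_mono) (use bds(2) in auto)
qed

text \<open>A decision sees only the prefix up to its own request, so appending \<open>r\<close>
  leaves all earlier terms as they are. The weights \<open>w\<close> serve both the accepted amount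
  and the reward.\<close>

lemma sum_accepted_snoc:
  "(\<Sum>i<length (\<sigma> @ [r]). w i * A \<omega> (take (Suc i) (\<sigma> @ [r])))
     = (\<Sum>i<length \<sigma>. w i * A \<omega> (take (Suc i) \<sigma>)) + w (length \<sigma>) * A \<omega> (\<sigma> @ [r])"
  for w :: "nat \<Rightarrow> real" and A :: algorithm
  by (simp add: sum.lessThan_Suc)

lemma expected_accepted_snoc:
  assumes "online_algorithm m M A" "valid_seq (\<sigma> @ [r])"
  shows "expected_accepted M A (\<sigma> @ [r]) = expected_accepted M A \<sigma> + (LINT \<omega>|M. A \<omega> (\<sigma> @ [r]))"
    and "0 \<le> (LINT \<omega>|M. A \<omega> (\<sigma> @ [r]))" "(LINT \<omega>|M. A \<omega> (\<sigma> @ [r])) \<le> amount r"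
proof -
  interpret prob_space M using assms(1) by (simp add: online_algorithm_def)
  have v: "valid_seq \<sigma>" using assms(2) by (auto simp: valid_seq_def)
  have 1: "integrable M (\<lambda>\<omega>. A \<omega> (\<sigma> @ [r]))"
    using integrable_accepted[OF assms, of "length \<sigma>"] by simp
  have 2: "integrable M (\<lambda>\<omega>. \<Sum>i<length \<sigma>. A \<omega> (take (Suc i) \<sigma>))"
    using integrable_accepted[OF assms(1) v] by auto
  show "expected_accepted M A (\<sigma> @ [r]) = expected_accepted M A \<sigma> + (LINT \<omega>|M. A \<omega> (\<sigma> @ [r]))"
    unfolding expected_accepted_def
    using sum_accepted_snoc[of "\<lambda>_. 1" A _ \<sigma> r] 1 2 by simp
  show "0 \<le> (LINT \<omega>|M. A \<omega> (\<sigma> @ [r]))"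
    using online_algorithm_bounds(1)[OF assms, of _ "length \<sigma>"]
    by (intro integral_ge_const 1 AE_I2) auto
  show "(LINT \<omega>|M. A \<omega> (\<sigma> @ [r])) \<le> amount r"
    using online_algorithm_bounds(2)[OF assms, of _ "length \<sigma>"]
    by (intro integral_le_const 1 AE_I2) auto
qed

text \<open>The final high request yields at most its size and, in expectation, at most the capacity
  that the low requests are expected to leave.\<close>

lemma expected_reward_le:
  assumes "online_algorithm m M A" "valid_seq \<tau>" "\<forall>r\<in>set \<tau>. \<exists>q. r = Low q" "0 \<le> y" "0 < rh"
  shows "expected_reward rl rh M A (\<tau> @ [High y])
    \<le> rl * expected_accepted M A \<tau> + rh * min y (m - expected_accepted M A \<tau>)"
proof -
  interpret prob_space M using assms(1) by (simp add: online_algorithm_def)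
  have v: "valid_seq (\<tau> @ [High y])" using assms(2,4) by (auto simp: valid_seq_def)
  have 1: "integrable M (\<lambda>\<omega>. A \<omega> (\<tau> @ [High y]))"
    using integrable_accepted[OF assms(1) v, of "length \<tau>"] by simp
  have 2: "integrable M (\<lambda>\<omega>. \<Sum>i<length \<tau>. A \<omega> (take (Suc i) \<tau>))"
    using integrable_accepted[OF assms(1,2)] by auto
  have low: "unit_reward rl rh (\<tau> ! i) = rl" if "i < length \<tau>" for i
    using assms(3) nth_mem[OF that] by fastforce
  have "(\<Sum>i<length (\<tau> @ [High y]). unit_reward rl rh ((\<tau> @ [High y]) ! i) * A \<omega> (take (Suc i) (\<tau> @ [High y])))
      = rl * (\<Sum>i<length \<tau>. A \<omega> (take (Suc i) \<tau>)) + rh * A \<omega> (\<tau> @ [High y])" for \<omega>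
    by (simp add: sum_accepted_snoc sum_distrib_left nth_append low)
  then have eq: "expected_reward rl rh M A (\<tau> @ [High y])
      = rl * expected_accepted M A \<tau> + rh * (LINT \<omega>|M. A \<omega> (\<tau> @ [High y]))"
    unfolding expected_reward_def expected_accepted_def using 1 2 by simp
  have "(LINT \<omega>|M. A \<omega> (\<tau> @ [High y])) \<le> min y (m - expected_accepted M A \<tau>)"
    using expected_accepted_snoc[OF assms(1) v] expected_accepted_bounds(2)[OF assms(1) v] by simp
  then show ?thesis unfolding eq using assms(5) by simp
qed

lemma expected_reward_nonneg:
  assumes "online_algorithm m M A" "valid_seq \<sigma>" "0 \<le> rl" "0 \<le> rh"
  shows "0 \<le> expected_reward rl rh M A \<sigma>"
  unfolding expected_reward_def
proof (intro integral_nonneg_AE AE_I2 sum_nonneg mult_nonneg_nonneg)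
  fix \<omega> i
  show "0 \<le> unit_reward rl rh (\<sigma> ! i)" using assms(3,4) by (cases "\<sigma> ! i") auto
qed (use online_algorithm_bounds(1)[OF assms(1,2)] in auto)

lemma clairvoyant_nonneg:
  assumes "0 \<le> m" "0 \<le> rl" "0 \<le> rh" "0 \<le> x" "0 \<le> y"
  shows "0 \<le> clairvoyant m rl rh x y"
  using assms by (simp add: clairvoyant_def)

text \<open>Nonnegative demands bound all ratios below by 0, which makes the real infimum a genuine
  lower bound.\<close>

lemma consistent_ratio_le_ratio_to_opt:
  assumes "online_algorithm m M A" "valid_seq \<sigma>" "demand \<sigma> = (x, y)" "(x, y) \<in> \<R>"
    and "0 \<le> m" "0 \<le> rl" "0 \<le> rh" "\<And>x y. (x, y) \<in> \<R> \<Longrightarrow> 0 \<le> x \<and> 0 \<le> y"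
  shows "consistent_ratio m rl rh \<R> M A
    \<le> ratio_to_opt (expected_reward rl rh M A \<sigma>) (clairvoyant m rl rh x y)"
proof -
  define f where "f = (\<lambda>\<sigma>. ratio_to_opt (expected_reward rl rh M A \<sigma>)
          (clairvoyant m rl rh (fst (demand \<sigma>)) (snd (demand \<sigma>))))"
  have "consistent_ratio m rl rh \<R> M A \<le> f \<sigma>"
    unfolding consistent_ratio_def f_def[symmetric]
  proof (rule cINF_lower)
    have "0 \<le> f \<sigma>" if "valid_seq \<sigma>" "demand \<sigma> \<in> \<R>" for \<sigma>
      unfolding f_def ratio_to_opt_def
      using assms(8)[of "fst (demand \<sigma>)" "snd (demand \<sigma>)"] that
      by (simp add: clairvoyant_nonneg expected_reward_nonneg[OF assms(1)] assms(5-7))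
    then show "bdd_below (f ` {\<sigma>. valid_seq \<sigma> \<and> demand \<sigma> \<in> \<R>})"
      by (intro bdd_belowI[of _ 0]) auto
  qed (use assms in auto)
  then show ?thesis by (simp add: f_def assms(3))
qed

lemma consistent_ratio_mult_clairvoyant_le:
  assumes "online_algorithm m M A" "valid_seq \<sigma>" "demand \<sigma> = (x, y)" "(x, y) \<in> \<R>"
    and "0 \<le> m" "0 \<le> rl" "0 \<le> rh" "\<And>x y. (x, y) \<in> \<R> \<Longrightarrow> 0 \<le> x \<and> 0 \<le> y"
  shows "consistent_ratio m rl rh \<R> M A * clairvoyant m rl rh x y \<le> expected_reward rl rh M A \<sigma>"
proof -
  have "0 \<le> clairvoyant m rl rh x y"
    using assms(4-8) clairvoyant_nonneg by simp
  with consistent_ratio_le_ratio_to_opt[OF assms] expected_reward_nonneg[OF assms(1,2,6,7)]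
  show ?thesis
    by (auto simp: ratio_to_opt_def pos_le_divide_eq split: if_splits)
qed

text \<open>The numerators of \<open>CP_u\<close> and \<open>CP_o\<close> are continuous in
  \<open>p\<close> and \<open>y\<close>, whereas the ratios may jump where the optimum
  vanishes.\<close>

definition CP_u_num :: "real \<Rightarrow> real \<Rightarrow> real \<Rightarrow> real \<Rightarrow> real \<Rightarrow> real \<Rightarrow> real" where
  "CP_u_num m rl rh p x y = max p (min y (max (m - x) 0)) * rh + min x (m - p) * rl"

definition CP_o_num :: "real \<Rightarrow> real \<Rightarrow> real \<Rightarrow> real \<Rightarrow> real \<Rightarrow> real \<Rightarrow> real" where
  "CP_o_num m rl rh p x y = min y m * rh + min x (max (m - p) 0) * rl"

text \<open>With low demand first, the amount expected to be left over for high demand acts as a protection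
  level; stating this without division covers a vanishing optimum and survives limits.\<close>

lemma consistent_ratio_le_CP_num:
  assumes "online_algorithm m M A" "valid_seq \<tau>" "\<forall>r\<in>set \<tau>. \<exists>q. r = Low q"
    and "demand \<tau> = (x, 0)" "(x, y) \<in> \<R>"
    and "0 \<le> m" "0 < rl" "rl < rh" "\<And>x y. (x, y) \<in> \<R> \<Longrightarrow> 0 \<le> x \<and> 0 \<le> y"
  defines "p \<equiv> m - expected_accepted M A \<tau>" and "c \<equiv> consistent_ratio m rl rh \<R> M A"
  shows "c * clairvoyant m rl rh x y \<le> CP_u_num m rl rh p x y"
    and "c * clairvoyant m rl rh x y \<le> CP_o_num m rl rh p x y"
    and "c * clairvoyant m rl rh x y \<le> clairvoyant m rl rh x y"
proof -
  have xy: "0 \<le> x" "0 \<le> y" using assms(5,9) by auto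
  have "demand (\<tau> @ [High y]) = (x, y)"
    using assms(4) by (simp add: demand_def)
  moreover have "valid_seq (\<tau> @ [High y])"
    using assms(2) xy by (auto simp: valid_seq_def)
  ultimately have "c * clairvoyant m rl rh x y \<le> expected_reward rl rh M A (\<tau> @ [High y])"
    unfolding c_def using assms(1,5-9)
    by (intro consistent_ratio_mult_clairvoyant_le[where \<R> = \<R>]) auto
  also have "\<dots> \<le> rl * (m - p) + rh * min y p"
    using expected_reward_le[OF assms(1-3) xy(2), of rh rl] assms(7,8) by (simp add: p_def)
  finally have le: "c * clairvoyant m rl rh x y \<le> rl * (m - p) + rh * min y p" .
  have "(\<Sum>i<length \<tau>. amount (\<tau> ! i)) = (\<Sum>i<length \<tau>. low_amount (\<tau> ! i))"
    using assms(3) nth_mem by (intro sum.cong) fastforce+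
  also have "\<dots> = x"
    using assms(4) by (simp add: demand_def sum_list_sum_nth atLeast0LessThan)
  \<comment> \<open>No more low demand is accepted than arrives, so \<open>m - p \<le> x\<close>;
    this turns \<open>min x (m - p)\<close> into \<open>m - p\<close> in both numerators.\<close>
  finally have px: "m - p \<le> x" "0 \<le> p" "p \<le> m"
    using expected_accepted_bounds[OF assms(1,2)] by (simp_all add: p_def)
  have "rh * min y p \<le> rh * max p (min y (max (m - x) 0))"
    using assms(7,8) by (intro mult_left_mono) auto
  then show "c * clairvoyant m rl rh x y \<le> CP_u_num m rl rh p x y"
    using le px by (simp add: CP_u_num_def min_absorb2 algebra_simps)
  have "rh * min y p \<le> rh * min y m"
    using assms(7,8) px by (intro mult_left_mono) auto
  then show "c * clairvoyant m rl rh x y \<le> CP_o_num m rl rh p x y"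
    using le px by (simp add: CP_o_num_def min_absorb2 algebra_simps)
  \<comment> \<open>Exchange argument: either the accepted low amount \<open>m - p\<close> is at
    most that of the optimum, or each unit of excess displaces high demand and loses
    \<open>rh - rl\<close>.\<close>
  have "rl * (m - p) + rh * min y p \<le> clairvoyant m rl rh x y"
  proof (cases "m - p \<le> min x (max (m - y) 0)")
    case True
    then have "rl * (m - p) \<le> rl * min x (max (m - y) 0)"
      using assms(7) by (intro mult_left_mono) auto
    then show ?thesis
      using \<open>rh * min y p \<le> rh * min y m\<close> by (simp add: clairvoyant_def algebra_simps)
  next
    case False
    then have *: "p \<le> y" "max (m - y) 0 \<le> x" "m = min y m + max (m - y) 0" "p \<le> min y m"
      using px by auto
    have "0 \<le> (rh - rl) * (min y m - p)"
      using * assms(8) by (intro mult_nonneg_nonneg) auto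
    moreover have eq: "min x (max (m - y) 0) = m - min y m" "min y p = p" using * by auto
    ultimately show ?thesis unfolding clairvoyant_def eq by (simp add: algebra_simps)
  qed
  with le show "c * clairvoyant m rl rh x y \<le> clairvoyant m rl rh x y" by simp
qed

section \<open>Near-optimal algorithms and the protection bounds\<close>

lemma online_algorithm_zero:
  assumes "0 \<le> m"
  shows "online_algorithm m (return borel 0) (\<lambda>_ _. 0)"
  using assms by (simp add: online_algorithm_def valid_seq_def prob_space_return)

lemma consistent_ratio_le_1:
  assumes "online_algorithm m M A" "\<R> \<noteq> {}"
    and "0 < m" "0 < rl" "rl < rh" "\<And>x y. (x, y) \<in> \<R> \<Longrightarrow> 0 \<le> x \<and> 0 \<le> y"
  shows "consistent_ratio m rl rh \<R> M A \<le> 1"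
proof -
  obtain x y where xy: "(x, y) \<in> \<R>" using assms(2) by auto
  then have nn: "0 \<le> x" "0 \<le> y" using assms(6) by auto
  show ?thesis
  proof (cases "clairvoyant m rl rh x y = 0")
    case False
    moreover have "0 \<le> clairvoyant m rl rh x y" using assms nn by (intro clairvoyant_nonneg) auto
    moreover have "consistent_ratio m rl rh \<R> M A * clairvoyant m rl rh x y \<le> clairvoyant m rl rh x y"
      using assms xy nn
      by (intro consistent_ratio_le_CP_num(3)[where \<tau> = "[Low x]"])
        (auto simp: valid_seq_def demand_def)
    ultimately show ?thesis by (simp add: mult_le_cancel_right2)
  next
    case True
    then show ?thesis
      using consistent_ratio_le_ratio_to_opt[OF assms(1), of "[Low x, High y]" x y \<R> rl rh] assms xy nn
      by (simp add: valid_seq_def demand_def ratio_to_opt_def)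
  qed
qed

lemma C_star_approx:
  assumes "\<R> \<noteq> {}" "0 < m" "0 < rl" "rl < rh" "\<And>x y. (x, y) \<in> \<R> \<Longrightarrow> 0 \<le> x \<and> 0 \<le> y"
  shows "C_star m rl rh \<R> \<le> 1"
    and "c < C_star m rl rh \<R> \<Longrightarrow> \<exists>M A. online_algorithm m M A \<and> c < consistent_ratio m rl rh \<R> M A"
proof -
  let ?X = "{consistent_ratio m rl rh \<R> M A | M A. online_algorithm m M A}"
  have ne: "?X \<noteq> {}" using online_algorithm_zero[of m] assms(2) by auto
  have le: "z \<le> 1" if "z \<in> ?X" for z using that consistent_ratio_le_1 assms by blast
  show "C_star m rl rh \<R> \<le> 1" unfolding C_star_def using ne le by (rule cSup_least)
  show "\<exists>M A. online_algorithm m M A \<and> c < consistent_ratio m rl rh \<R> M A" if "c < C_star m rl rh \<R>"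
    using less_cSupE[OF that[unfolded C_star_def] ne] by blast
qed

section \<open>Monotonicity in the protection level and the solved bounds\<close>

lemma CP_u_num_mono:
  assumes "0 < rl" "rl < rh" "0 \<le> p" "p \<le> q"
  shows "CP_u_num m rl rh p x y \<le> CP_u_num m rl rh q x y"
proof -
  define t where "t = min y (max (m - x) 0)"
  have t: "t \<le> max (m - x) 0" by (simp add: t_def)
  note defs = CP_u_num_def t_def[symmetric]
  \<comment> \<open>The numerator has a kink at level \<open>m - x\<close>: above it a further
    protected unit replaces low by high demand and gains \<open>rh - rl\<close>; below it all low
    demand fits and more protection costs nothing. The third case straddles the kink.\<close>
  consider "m - p \<le> x" | "x \<le> m - q" | "m - q < x" "x < m - p" by linarith
  then show ?thesis
  proof cases
    case 1
    have "0 \<le> (q - p) * (rh - rl)" using assms by simp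
    moreover have "max p t = p" "max q t = q" "min x (m - p) = m - p" "min x (m - q) = m - q"
      using 1 assms t by auto
    ultimately show ?thesis by (simp add: defs algebra_simps)
  next
    case 2
    then have "min x (m - p) = x" "min x (m - q) = x" using assms by auto
    moreover have "max p t * rh \<le> max q t * rh" using assms by (intro mult_right_mono) auto
    ultimately show ?thesis by (simp add: defs)
  next
    case 3
    have "max p t * rh \<le> (m - x) * rh"
      using assms t 3 by (intro mult_right_mono) auto
    moreover have "0 \<le> (q - (m - x)) * (rh - rl)" using assms 3 by simp
    moreover have "max q t = q" "min x (m - p) = x" "min x (m - q) = m - q"
      using 3 assms t by auto
    ultimately show ?thesis by (simp add: defs algebra_simps)
  qed
qed

lemma CP_o_num_antimono:
  assumes "0 \<le> rl" "p \<le> q"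
  shows "CP_o_num m rl rh q x y \<le> CP_o_num m rl rh p x y"
  using assms unfolding CP_o_num_def by (intro add_left_mono mult_right_mono) auto

text \<open>If a solution \<open>s\<close> lies above \<open>p\<close>, monotonicity squeezes the
  numerator at \<open>p\<close> between \<open>C\<close> times the optimum and the numerator at
  \<open>s\<close>, which coincide; so \<open>p\<close> is a solution too. If the optimum vanishes,
  all levels have the same ratio 1.\<close>

lemma l_solve_le:
  assumes "0 < m" "0 < rl" "rl < rh" "0 \<le> x" "0 \<le> h_hi \<R> x" "0 \<le> p" "p \<le> m"
    and le: "C * clairvoyant m rl rh x (h_hi \<R> x) \<le> CP_u_num m rl rh p x (h_hi \<R> x)"
  shows "l_solve m rl rh \<R> C x \<le> p"
proof -
  define S where "S = {p \<in> {0..m}. CP_u m rl rh p x (h_hi \<R> x) = C}"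
  define opt where "opt = clairvoyant m rl rh x (h_hi \<R> x)"
  have CP: "CP_u m rl rh p x (h_hi \<R> x) = ratio_to_opt (CP_u_num m rl rh p x (h_hi \<R> x)) opt" for p
    by (simp add: CP_u_def CP_u_num_def opt_def)
  have opt: "0 \<le> opt" unfolding opt_def using assms by (intro clairvoyant_nonneg) auto
  have solve: "l_solve m rl rh \<R> C x = (if S = {} then 0 else Inf S)"
    by (simp only: l_solve_def S_def Let_def)
  have bdd: "bdd_below S" unfolding S_def by (intro bdd_belowI[of _ 0]) auto
  show ?thesis
  proof (cases "S = {}")
    case True
    then show ?thesis using assms by (simp add: solve)
  next
    case False
    then obtain s where s: "s \<in> S" by auto
    have "Inf S \<le> p"
    proof (cases "s \<le> p")
      case True
      then show ?thesis using cInf_lower[OF s bdd] by linarith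
    next
      case False
      have "CP_u_num m rl rh p x (h_hi \<R> x) \<le> CP_u_num m rl rh s x (h_hi \<R> x)"
        using False assms by (intro CP_u_num_mono) auto
      then have "p \<in> S"
        using s assms(6,7) le opt
        by (auto simp: S_def CP ratio_to_opt_def opt_def[symmetric] field_simps split: if_splits)
      then show ?thesis using cInf_lower[OF _ bdd] by simp
    qed
    then show ?thesis using False by (simp add: solve)
  qed
qed

text \<open>Mirror image of \<open>l_solve_le\<close>: a solution below \<open>p\<close> makes
  \<open>p\<close> a solution, and the default for an empty set is the largest level
  \<open>m\<close>.\<close>

lemma u_solve_ge:
  assumes "0 < m" "0 < rl" "rl < rh" "0 \<le> x" "0 \<le> h_lo \<R> x" "0 \<le> p" "p \<le> m"
    and le: "C * clairvoyant m rl rh x (h_lo \<R> x) \<le> CP_o_num m rl rh p x (h_lo \<R> x)"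
  shows "p \<le> u_solve m rl rh \<R> C x"
proof -
  define S where "S = {p \<in> {0..m}. CP_o m rl rh p x (h_lo \<R> x) = C}"
  define opt where "opt = clairvoyant m rl rh x (h_lo \<R> x)"
  have CP: "CP_o m rl rh p x (h_lo \<R> x) = ratio_to_opt (CP_o_num m rl rh p x (h_lo \<R> x)) opt" for p
    by (simp add: CP_o_def CP_o_num_def opt_def)
  have opt: "0 \<le> opt" unfolding opt_def using assms by (intro clairvoyant_nonneg) auto
  have solve: "u_solve m rl rh \<R> C x = (if S = {} then m else Sup S)"
    by (simp only: u_solve_def S_def Let_def)
  have bdd: "bdd_above S" unfolding S_def by (intro bdd_aboveI[of _ m]) auto
  show ?thesis
  proof (cases "S = {}")
    case True
    then show ?thesis using assms by (simp add: solve)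
  next
    case False
    then obtain s where s: "s \<in> S" by auto
    have "p \<le> Sup S"
    proof (cases "p \<le> s")
      case True
      then show ?thesis using cSup_upper[OF s bdd] by linarith
    next
      case False
      have "CP_o_num m rl rh p x (h_lo \<R> x) \<le> CP_o_num m rl rh s x (h_lo \<R> x)"
        using False assms by (intro CP_o_num_antimono) auto
      then have "p \<in> S"
        using s assms(6,7) le opt
        by (auto simp: S_def CP ratio_to_opt_def opt_def[symmetric] field_simps split: if_splits)
      then show ?thesis using cSup_upper[OF _ bdd] by simp
    qed
    then show ?thesis using False by (simp add: solve)
  qed
qed

lemma l_solve_nonneg:
  assumes "0 \<le> m"
  shows "0 \<le> l_solve m rl rh \<R> C x"
  unfolding l_solve_def Let_def by (auto intro: cInf_greatest)

lemma u_solve_le: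
  assumes "0 \<le> m"
  shows "u_solve m rl rh \<R> C x \<le> m"
  unfolding u_solve_def Let_def by (auto intro: cSup_least)

section \<open>Protection levels extracted from algorithms\<close>

lemma approx_protection_levels:
  assumes "0 < m" "0 < rl" "rl < rh" and nn: "\<And>x y. (x, y) \<in> \<R> \<Longrightarrow> 0 \<le> x \<and> 0 \<le> y"
    and "c < C_star m rl rh \<R>" "x \<in> fst ` \<R>" "z \<in> fst ` \<R>"
  shows "\<exists>p q. 0 \<le> p \<and> p \<le> m \<and> 0 \<le> q \<and> q \<le> m \<and> p \<le> q + max 0 (z - x) \<and>
    (\<forall>y. (x, y) \<in> \<R> \<longrightarrow> c * clairvoyant m rl rh x y \<le> CP_u_num m rl rh p x y) \<and>
    (\<forall>y. (z, y) \<in> \<R> \<longrightarrow> c * clairvoyant m rl rh z y \<le> CP_o_num m rl rh q z y)"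
proof -
  have ne: "\<R> \<noteq> {}" using assms(6) by auto
  obtain M A where A: "online_algorithm m M A" and c: "c < consistent_ratio m rl rh \<R> M A"
    using C_star_approx(2)[OF ne assms(1-5)] by blast
  have pos: "0 \<le> x" "0 \<le> z" using assms(6,7) nn by auto
  \<comment> \<open>\<open>\<tau> x z\<close> and \<open>\<tau> z x\<close> carry low demand
    \<open>x\<close> and \<open>z\<close>, arranged so that the shorter is a prefix of the longer;
    the two levels then come from one run of the algorithm.\<close>
  define \<tau> where "\<tau> a b = (if a \<le> b then [Low a] else [Low b, Low (a - b)])" for a b
  define p where "p = m - expected_accepted M A (\<tau> x z)"
  define q where "q = m - expected_accepted M A (\<tau> z x)"
  have v: "valid_seq (\<tau> x z)" "valid_seq (\<tau> z x)"
    "\<forall>r\<in>set (\<tau> x z). \<exists>q. r = Low q" "\<forall>r\<in>set (\<tau> z x). \<exists>q. r = Low q"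
    "demand (\<tau> x z) = (x, 0)" "demand (\<tau> z x) = (z, 0)"
    using pos by (auto simp: \<tau>_def valid_seq_def demand_def)
  \<comment> \<open>A longer run can only lower the remaining capacity, and by no more than the
    extra demand: for \<open>z < x\<close> this gives \<open>p \<le> q\<close>, for
    \<open>x < z\<close> it gives \<open>p \<le> q + (z - x)\<close>.\<close>
  have "p \<le> q + max 0 (z - x)"
  proof -
    consider "x = z" | "x < z" | "z < x" by linarith
    then show ?thesis
    proof cases
      case 1
      then show ?thesis by (simp add: p_def q_def)
    next
      case 2
      have "valid_seq ([Low x] @ [Low (z - x)])" using pos 2 by (auto simp: valid_seq_def)
      from expected_accepted_snoc[OF A this] 2 show ?thesis by (simp add: p_def q_def \<tau>_def)
    next
      case 3
      have "valid_seq ([Low z] @ [Low (x - z)])" using pos 3 by (auto simp: valid_seq_def)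
      from expected_accepted_snoc[OF A this] 3 show ?thesis by (simp add: p_def q_def \<tau>_def)
    qed
  qed
  moreover have "c * clairvoyant m rl rh a b \<le> consistent_ratio m rl rh \<R> M A * clairvoyant m rl rh a b"
    if "(a, b) \<in> \<R>" for a b
    using that nn[OF that] assms(1-3) c by (intro mult_right_mono clairvoyant_nonneg) auto
  then have "\<forall>y. (x, y) \<in> \<R> \<longrightarrow> c * clairvoyant m rl rh x y \<le> CP_u_num m rl rh p x y"
    "\<forall>y. (z, y) \<in> \<R> \<longrightarrow> c * clairvoyant m rl rh z y \<le> CP_o_num m rl rh q z y"
    using consistent_ratio_le_CP_num(1)[OF A v(1,3,5), of _ \<R> rl rh]
      consistent_ratio_le_CP_num(2)[OF A v(2,4,6), of _ \<R> rl rh] assms(1-4)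
    unfolding p_def q_def by (meson order_trans less_imp_le)+
  ultimately show ?thesis
    using expected_accepted_bounds[OF A v(1)] expected_accepted_bounds[OF A v(2)]
    by (intro exI[of _ p] exI[of _ q]) (auto simp: p_def q_def)
qed

text \<open>\<open>C\<close> may equal a supremum that no algorithm attains. Levels for ratios
  increasing to \<open>C\<close> lie in a compact square, and the inequalities are closed in the
  ratio and the levels, so they hold at a limit point.\<close>

lemma protection_levels:
  assumes "0 < m" "0 < rl" "rl < rh" and nn: "\<And>x y. (x, y) \<in> \<R> \<Longrightarrow> 0 \<le> x \<and> 0 \<le> y"
    and "C \<le> C_star m rl rh \<R>" "x \<in> fst ` \<R>" "z \<in> fst ` \<R>"
  obtains p q where "0 \<le> p" "p \<le> m" "0 \<le> q" "q \<le> m" "p \<le> q + max 0 (z - x)"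
    and "\<And>y. (x, y) \<in> \<R> \<Longrightarrow> C * clairvoyant m rl rh x y \<le> CP_u_num m rl rh p x y"
    and "\<And>y. (z, y) \<in> \<R> \<Longrightarrow> C * clairvoyant m rl rh z y \<le> CP_o_num m rl rh q z y"
proof -
  define c where "c n = C - 1 / real (Suc n)" for n
  have c: "c \<longlonglongrightarrow> C"
    unfolding c_def using tendsto_diff[OF tendsto_const LIMSEQ_inverse_real_of_nat, of C]
    by (simp add: inverse_eq_divide)
  define P where "P n pq \<longleftrightarrow> (case pq of (p, q) \<Rightarrow> 0 \<le> p \<and> p \<le> m \<and> 0 \<le> q \<and> q \<le> m \<and> p \<le> q + max 0 (z - x) \<and>
    (\<forall>y. (x, y) \<in> \<R> \<longrightarrow> c n * clairvoyant m rl rh x y \<le> CP_u_num m rl rh p x y) \<and>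
    (\<forall>y. (z, y) \<in> \<R> \<longrightarrow> c n * clairvoyant m rl rh z y \<le> CP_o_num m rl rh q z y))" for n pq
  have "\<exists>pq. P n pq" for n
  proof -
    have "c n < C" by (simp add: c_def)
    then show ?thesis
      using approx_protection_levels[OF assms(1-4) _ assms(6,7), of "c n"] assms(5)
      unfolding P_def by auto
  qed
  then obtain w where w: "\<And>n. P n (w n)" by metis
  have "compact ({0..m} \<times> {0..m})" by (intro compact_Times compact_Icc)
  moreover have "w n \<in> {0..m} \<times> {0..m}" for n
    using w[of n] by (auto simp: P_def split: prod.splits)
  ultimately obtain l r where l: "l \<in> {0..m} \<times> {0..m}" "strict_mono r" "(w \<circ> r) \<longlonglongrightarrow> l"
    unfolding compact_def by metis
  define p q where "p = fst l" and "q = snd l"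
  have lim: "(\<lambda>n. fst (w (r n))) \<longlonglongrightarrow> p" "(\<lambda>n. snd (w (r n))) \<longlonglongrightarrow> q"
    using tendsto_fst[OF l(3)] tendsto_snd[OF l(3)] by (auto simp: p_def q_def o_def)
  have cr: "(\<lambda>n. c (r n)) \<longlonglongrightarrow> C"
    using LIMSEQ_subseq_LIMSEQ[OF c l(2)] by (simp add: o_def)
  have w': "fst (w n) \<le> snd (w n) + max 0 (z - x)"
    "(x, y) \<in> \<R> \<Longrightarrow> c n * clairvoyant m rl rh x y \<le> CP_u_num m rl rh (fst (w n)) x y"
    "(z, y) \<in> \<R> \<Longrightarrow> c n * clairvoyant m rl rh z y \<le> CP_o_num m rl rh (snd (w n)) z y" for n y
    using w[of n] by (auto simp: P_def split: prod.splits)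
  show thesis
  proof (rule that)
    show "0 \<le> p" "p \<le> m" "0 \<le> q" "q \<le> m" using l(1) by (auto simp: p_def q_def)
    show "p \<le> q + max 0 (z - x)"
      using w'(1) by (intro LIMSEQ_le[OF lim(1) tendsto_add[OF lim(2) tendsto_const]]) auto
    show "C * clairvoyant m rl rh x y \<le> CP_u_num m rl rh p x y" if "(x, y) \<in> \<R>" for y
    proof (rule LIMSEQ_le)
      show "(\<lambda>n. c (r n) * clairvoyant m rl rh x y) \<longlonglongrightarrow> C * clairvoyant m rl rh x y"
        by (intro tendsto_intros cr)
      show "(\<lambda>n. CP_u_num m rl rh (fst (w (r n))) x y) \<longlonglongrightarrow> CP_u_num m rl rh p x y"
        unfolding CP_u_num_def by (intro tendsto_intros lim)
    qed (use w'(2) that in auto)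
    show "C * clairvoyant m rl rh z y \<le> CP_o_num m rl rh q z y" if "(z, y) \<in> \<R>" for y
    proof (rule LIMSEQ_le)
      show "(\<lambda>n. c (r n) * clairvoyant m rl rh z y) \<longlonglongrightarrow> C * clairvoyant m rl rh z y"
        by (intro tendsto_intros cr)
      show "(\<lambda>n. CP_o_num m rl rh (snd (w (r n))) z y) \<longlonglongrightarrow> CP_o_num m rl rh q z y"
        unfolding CP_o_num_def by (intro tendsto_intros lim)
    qed (use w'(3) that in auto)
  qed
qed

text \<open>Sections of the region are not assumed closed, so their extreme values may lie outside
  of it; membership in the closure suffices to transfer closed conditions.\<close>

lemma section_bounds:
  assumes "bounded \<R>" "\<And>x y. (x, y) \<in> \<R> \<Longrightarrow> 0 \<le> x \<and> 0 \<le> y" "x \<in> fst ` \<R>"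
  shows "h_hi \<R> x \<in> closure {y. (x, y) \<in> \<R>}" "h_lo \<R> x \<in> closure {y. (x, y) \<in> \<R>}"
    "0 \<le> h_hi \<R> x" "0 \<le> h_lo \<R> x"
proof -
  have ne: "{y. (x, y) \<in> \<R>} \<noteq> {}" using assms(3) by auto
  have "bounded (snd ` \<R>)" using assms(1) by (rule bounded_snd)
  then have "bdd_above (snd ` \<R>)" by (rule bounded_imp_bdd_above)
  then have above: "bdd_above {y. (x, y) \<in> \<R>}" by (rule bdd_above_mono) force
  have below: "bdd_below {y. (x, y) \<in> \<R>}" using assms(2) by (intro bdd_belowI[of _ 0]) auto
  show 1: "h_hi \<R> x \<in> closure {y. (x, y) \<in> \<R>}"
    unfolding h_hi_def by (rule closure_contains_Sup[OF ne above])
  show 2: "h_lo \<R> x \<in> closure {y. (x, y) \<in> \<R>}"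
    unfolding h_lo_def by (rule closure_contains_Inf[OF ne below])
  have "closure {y. (x, y) \<in> \<R>} \<subseteq> {0..}"
    using assms(2) by (intro closure_minimal) auto
  then show "0 \<le> h_hi \<R> x" "0 \<le> h_lo \<R> x" using 1 2 by auto
qed

text \<open>The levels of \<open>protection_levels\<close> separate the two solved bounds:
  \<open>l_solve\<close> is at most \<open>p\<close>, \<open>u_solve\<close> at least
  \<open>q\<close>, and \<open>p\<close> exceeds \<open>q\<close> by at most the additional low
  demand.\<close>

lemma l_solve_u_solve:
  assumes "0 < m" "0 < rl" "rl < rh" "\<And>x y. (x, y) \<in> \<R> \<Longrightarrow> 0 \<le> x \<and> 0 \<le> y" "bounded \<R>"
    and "C \<le> C_star m rl rh \<R>" "x \<in> fst ` \<R>" "z \<in> fst ` \<R>"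
  shows "l_solve m rl rh \<R> C x \<le> u_solve m rl rh \<R> C z + max 0 (z - x)"
    and "0 \<le> u_solve m rl rh \<R> C z"
proof -
  obtain p q where pq: "0 \<le> p" "p \<le> m" "0 \<le> q" "q \<le> m" "p \<le> q + max 0 (z - x)"
    and p: "\<And>y. (x, y) \<in> \<R> \<Longrightarrow> C * clairvoyant m rl rh x y \<le> CP_u_num m rl rh p x y"
    and q: "\<And>y. (z, y) \<in> \<R> \<Longrightarrow> C * clairvoyant m rl rh z y \<le> CP_o_num m rl rh q z y"
    using protection_levels[OF assms(1-4,6-8)] by metis
  have "closed {y. C * clairvoyant m rl rh x y \<le> CP_u_num m rl rh p x y}"
    unfolding clairvoyant_def CP_u_num_def
    by (intro closed_Collect_le continuous_intros)
  then have "closure {y. (x, y) \<in> \<R>} \<subseteq> {y. C * clairvoyant m rl rh x y \<le> CP_u_num m rl rh p x y}"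
    using p by (intro closure_minimal) auto
  then have "l_solve m rl rh \<R> C x \<le> p"
    using section_bounds[OF assms(5,4,7)] assms(1-4,7) pq by (intro l_solve_le) auto
  moreover have "closed {y. C * clairvoyant m rl rh z y \<le> CP_o_num m rl rh q z y}"
    unfolding clairvoyant_def CP_o_num_def
    by (intro closed_Collect_le continuous_intros)
  then have "closure {y. (z, y) \<in> \<R>} \<subseteq> {y. C * clairvoyant m rl rh z y \<le> CP_o_num m rl rh q z y}"
    using q by (intro closure_minimal) auto
  then have "q \<le> u_solve m rl rh \<R> C z"
    using section_bounds[OF assms(5,4,8)] assms(1-4,8) pq by (intro u_solve_ge) auto
  ultimately show "l_solve m rl rh \<R> C x \<le> u_solve m rl rh \<R> C z + max 0 (z - x)"
    "0 \<le> u_solve m rl rh \<R> C z" using pq by auto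
qed

section \<open>End points of the region and of the bounds\<close>

lemma fst_image_Icc:
  assumes "convex \<R>" "bounded \<R>" "closed (fst ` \<R>)" "q \<in> \<R>"
  shows "fst q \<le> x_hi \<R>" "{fst q..x_hi \<R>} \<subseteq> fst ` \<R>"
proof -
  have "bdd_above (fst ` \<R>)" using assms(2) by (intro bounded_imp_bdd_above bounded_fst)
  then show "fst q \<le> x_hi \<R>" unfolding x_hi_def using assms(4) by (intro cSUP_upper)
  have "x_hi \<R> \<in> fst ` \<R>"
    unfolding x_hi_def using assms(3,4) \<open>bdd_above _\<close> by (intro closed_contains_Sup) auto
  moreover have "connected (fst ` \<R>)"
    using assms(1) by (intro connected_continuous_image convex_connected continuous_intros)
  ultimately show "{fst q..x_hi \<R>} \<subseteq> fst ` \<R>"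
    using assms(4) by (intro connected_contains_Icc) auto
qed

lemma xu_hi_bounds:
  assumes "fst L \<le> x_hi \<R>"
  shows "fst L \<le> xu_hi m rl rh \<R> L C" "xu_hi m rl rh \<R> L C \<le> x_hi \<R>"
proof -
  let ?X = "insert (fst L) {x \<in> {fst L..x_hi \<R>}.
                ereal ((1 - C) * (rh / rl)) * left_deriv (H_lo m \<R>) x - ereal C < 0}"
  have "bdd_above ?X" using assms by (intro bdd_aboveI[of _ "x_hi \<R>"]) auto
  then have "fst L \<le> Sup ?X" by (intro cSup_upper) auto
  moreover have "Sup ?X \<le> x_hi \<R>" using assms by (intro cSup_least) auto
  ultimately show "fst L \<le> xu_hi m rl rh \<R> L C" "xu_hi m rl rh \<R> L C \<le> x_hi \<R>"
    using assms by (auto simp: xu_hi_def)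
qed

text \<open>In the second branch of \<open>x_minus1\<close> some left derivative fails to be at
  least -1 and hence lies below -1, so the supremum is over a nonempty set.\<close>

lemma x_minus1_bounds:
  assumes "fst H \<le> x_hi \<R>"
  shows "fst H \<le> x_minus1 m rl rh \<R> H C" "x_minus1 m rl rh \<R> H C \<le> x_hi \<R>"
proof -
  let ?X = "{x \<in> {fst H..x_hi \<R>}. left_deriv (l_bound m rl rh \<R> H C) x \<le> -1}"
  have "fst H \<le> Sup ?X \<and> Sup ?X \<le> x_hi \<R>"
    if ex: "\<not> (\<forall>x\<in>{fst H..x_hi \<R>}. left_deriv (l_bound m rl rh \<R> H C) x \<ge> -1)"
  proof -
    obtain x where x: "x \<in> ?X" using ex by fastforce
    have "bdd_above ?X" by (intro bdd_aboveI[of _ "x_hi \<R>"]) auto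
    then have "x \<le> Sup ?X" using x by (intro cSup_upper) auto
    moreover have "Sup ?X \<le> x_hi \<R>" using x by (intro cSup_least) auto
    ultimately show ?thesis using x by auto
  qed
  then show "fst H \<le> x_minus1 m rl rh \<R> H C" "x_minus1 m rl rh \<R> H C \<le> x_hi \<R>"
    using assms by (auto simp: x_minus1_def)
qed

lemma xu_lo_le:
  assumes "bdd_below (fst ` \<R>)" "L \<in> \<R>" "fst L \<le> x_hi \<R>"
  shows "xu_lo m rl rh \<R> L C \<le> xu_hi m rl rh \<R> L C"
proof -
  have "x_lo \<R> \<le> fst L" unfolding x_lo_def using assms by (intro cINF_lower)
  then have "x_lo \<R> \<le> xu_hi m rl rh \<R> L C" using xu_hi_bounds(1)[OF assms(3), of m rl rh C] by simp
  then show ?thesis unfolding xu_lo_def Let_def by (auto intro!: cSup_least)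
qed

text \<open>Both bounds at the right end of the region are inherited from a single point to its left:
  the lower bound decreases at slope at most one, like every protection level.\<close>

lemma protection_interval:
  assumes "0 < m" "0 < rl" "rl < rh" "convex \<R>" "\<And>x y. (x, y) \<in> \<R> \<Longrightarrow> 0 \<le> x \<and> 0 \<le> y"
    and "bounded \<R>" "closed (fst ` \<R>)" "L \<in> \<R>" "H \<in> \<R>" "C \<le> C_star m rl rh \<R>"
  defines "l \<equiv> l_tilde m rl rh \<R> H C (x_hi \<R>)" and "u \<equiv> u_bound m rl rh \<R> L C (x_hi \<R>)"
  shows "0 \<le> l" "l \<le> u" "u \<le> m"
proof -
  define x where "x = x_minus1 m rl rh \<R> H C"
  define z where "z = xu_hi m rl rh \<R> L C"
  note LH = fst_image_Icc[OF assms(4,6,7,8)] fst_image_Icc[OF assms(4,6,7,9)]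
  have x: "fst H \<le> x" "x \<le> x_hi \<R>" using x_minus1_bounds[OF LH(3)] by (auto simp: x_def)
  have z: "fst L \<le> z" "z \<le> x_hi \<R>" using xu_hi_bounds[OF LH(1)] by (auto simp: z_def)
  have xz: "x \<in> fst ` \<R>" "z \<in> fst ` \<R>" using x z LH(2,4) by auto
  have "bdd_below (fst ` \<R>)" using assms(5) by (intro bdd_belowI[of _ 0]) auto
  then have u: "u = u_solve m rl rh \<R> C z"
    using xu_lo_le[OF _ assms(8) LH(1), of m rl rh C] z
    by (auto simp: u_def u_bound_def z_def[symmetric])
  have lb: "l_bound m rl rh \<R> H C x \<in> {0, l_solve m rl rh \<R> C x}"
    using x by (auto simp: l_bound_def)
  have l: "l = max (l_bound m rl rh \<R> H C x - (x_hi \<R> - x)) 0"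
  proof (cases "x_hi \<R> \<le> x")
    case True
    then have "x_hi \<R> = x" using x by simp
    moreover have "0 \<le> l_bound m rl rh \<R> H C x"
      using lb l_solve_nonneg[of m rl rh \<R> C x] assms(1) by auto
    ultimately show ?thesis by (simp add: l_def l_tilde_def x_def[symmetric] Let_def)
  qed (simp add: l_def l_tilde_def x_def[symmetric] Let_def)
  show "0 \<le> l" by (simp add: l)
  \<comment> \<open>Since \<open>x\<close> and \<open>z\<close> are both at most
    \<open>x_hi \<R>\<close>, the slack \<open>max 0 (z - x)\<close> is covered by the decrease
    \<open>x_hi \<R> - x\<close> built into \<open>l_tilde\<close>.\<close>
  show "l \<le> u" using l_solve_u_solve[OF assms(1-3,5,6,10) xz] lb x z by (auto simp: l u)
  show "u \<le> m" unfolding u using assms(1) by (intro u_solve_le) simp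
qed

text \<open>In this degenerate case the ratio \<open>CP_o\<close> at the right end has the junk value 1.\<close>

lemma l_tilde_x_hi_eq_0:
  assumes "0 < m" "0 < rl" "rl < rh" "convex \<R>" "\<And>x y. (x, y) \<in> \<R> \<Longrightarrow> 0 \<le> x \<and> 0 \<le> y"
    and "bounded \<R>" "closed (fst ` \<R>)" "H \<in> \<R>" "C \<le> C_star m rl rh \<R>" "x_hi \<R> = 0"
  shows "l_tilde m rl rh \<R> H C (x_hi \<R>) = 0"
proof -
  note LH = fst_image_Icc[OF assms(4,6,7,8)]
  have H0: "fst H = 0" using LH(1) assms(5)[of "fst H" "snd H"] assms(8,10) by auto
  have ne: "\<R> \<noteq> {}" using assms(8) by auto
  have C: "C \<le> 1" using C_star_approx(1)[OF ne assms(1-3,5)] assms(9) by simp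
  have "0 \<in> fst ` \<R>" using assms(8) H0 by force
  then have h: "0 \<le> h_hi \<R> 0" using section_bounds[OF assms(6,5)] by auto
  \<comment> \<open>Without low demand, level 0 already earns the whole optimum, so
    \<open>C \<le> 1\<close> makes 0 an admissible level.\<close>
  have "C * clairvoyant m rl rh 0 (h_hi \<R> 0) \<le> 1 * clairvoyant m rl rh 0 (h_hi \<R> 0)"
    using C assms(1-3) h by (intro mult_right_mono clairvoyant_nonneg) auto
  also have "\<dots> = CP_u_num m rl rh 0 0 (h_hi \<R> 0)"
    using h assms(1) by (simp add: clairvoyant_def CP_u_num_def)
  finally have "l_solve m rl rh \<R> C 0 \<le> 0"
    using assms(1-3) h by (intro l_solve_le) auto
  then have "l_solve m rl rh \<R> C 0 = 0"
    using l_solve_nonneg[of m rl rh \<R> C 0] assms(1) by simp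
  then have "l_bound m rl rh \<R> H C 0 = 0" by (simp add: l_bound_def H0)
  moreover have "x_minus1 m rl rh \<R> H C = 0"
    using x_minus1_bounds[OF LH(1), of m rl rh C] H0 assms(10) by simp
  ultimately show ?thesis using assms(10) by (simp add: l_tilde_def)
qed

section \<open>The right problem\<close>

text \<open>\<open>ARG_MIN\<close> picks a minimizer by choice; the nearest point of an interval is
  unique, so the pick is the projection of \<open>g\<close>.\<close>

lemma arg_min_dist_Icc:
  fixes l u g :: real
  assumes "l \<le> u"
  shows "(ARG_MIN (\<lambda>p. \<bar>p - g\<bar>) p. p \<in> {l..u}) = max l (min u g)"
proof (rule arg_minI[where x = "max l (min u g)"])
  fix p assume "p \<in> {l..u}" "\<forall>q. q \<in> {l..u} \<longrightarrow> \<not> \<bar>q - g\<bar> < \<bar>p - g\<bar>"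
  then have "\<not> \<bar>max l (min u g) - g\<bar> < \<bar>p - g\<bar>" "l \<le> p" "p \<le> u" using assms by auto
  then show "p = max l (min u g)" by (auto simp: max_def min_def abs_if split: if_splits)
qed (use assms in \<open>auto simp: max_def min_def abs_if\<close>)

lemma \<rho>_bounds:
  assumes "0 < rl" "rl < rh"
  shows "rl / rh < \<rho> rl rh" "\<rho> rl rh < 1" "0 < \<rho> rl rh"
proof -
  define k where "k = rl / rh"
  have k: "0 < k" "k < 1" using assms by (auto simp: k_def)
  have "0 < (1 - k) * (1 - k)" using k by simp
  then have "k * (2 - k) < 1" by (simp add: algebra_simps)
  then show "rl / rh < \<rho> rl rh" "\<rho> rl rh < 1" "0 < \<rho> rl rh"
    using k by (auto simp: \<rho>_def k_def[symmetric] field_simps)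
qed

text \<open>\<open>m * (1 - R)\<close> is the value of the upper robustness bound from
  \<open>m\<close> on, so \<open>\<rho>\<close> is the ratio at which both bounds meet
  there.\<close>

lemma g_lo_\<rho>:
  assumes "0 < rl" "rl < rh"
  shows "g_lo m rl rh (\<rho> rl rh) x = m * (1 - \<rho> rl rh)"
proof -
  define k where "k = rl / rh"
  have "k < 1" using assms by (auto simp: k_def)
  then show ?thesis
    by (simp add: g_lo_def \<rho>_def k_def[symmetric] divide_simps) (simp add: algebra_simps)
qed

section \<open>Robustness bounds as inverses of compatible ratios\<close>

lemma CP_u_robust:
  assumes "0 < m" "0 < rl" "rl < rh" "m \<le> x" "0 \<le> p"
  shows "CP_u m rl rh p x m = rl / rh + (1 - rl / rh) * (p / m)"
proof -
  have "max p (min m (max (m - x) 0)) = p" "min x (m - p) = m - p" using assms by auto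
  then show ?thesis
    using assms by (simp add: CP_u_def clairvoyant_def ratio_to_opt_def field_simps)
qed

text \<open>For low demand at least \<open>m\<close>, \<open>CP_u\<close> is affine and increasing
  in the level by \<open>CP_u_robust\<close>; \<open>g_lo\<close> is its inverse, read off here as
  an inequality and below as two identities.\<close>

lemma g_lo_le_iff:
  assumes "0 < m" "0 < rl" "rl < rh" "m \<le> x" "0 \<le> p"
  shows "g_lo m rl rh R x' \<le> p \<longleftrightarrow> R \<le> CP_u m rl rh p x m"
proof -
  define k where "k = rl / rh"
  have "k < 1" using assms by (auto simp: k_def)
  then show ?thesis unfolding CP_u_robust[OF assms] g_lo_def k_def[symmetric]
    using assms(1) by (simp add: field_simps)
qed

lemma g_lo_CP_u:
  assumes "0 < m" "0 < rl" "rl < rh" "m \<le> x" "0 \<le> p"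
  shows "g_lo m rl rh (CP_u m rl rh p x m) x' = p"
proof -
  define k where "k = rl / rh"
  have "k < 1" using assms by (auto simp: k_def)
  then show ?thesis unfolding CP_u_robust[OF assms] g_lo_def k_def[symmetric]
    using assms(1) by (simp add: field_simps)
qed

lemma CP_u_g_lo:
  assumes "0 < m" "0 < rl" "rl < rh" "m \<le> x" "0 \<le> g_lo m rl rh R x'"
  shows "CP_u m rl rh (g_lo m rl rh R x') x m = R"
proof -
  define k where "k = rl / rh"
  have "k < 1" using assms by (auto simp: k_def)
  then show ?thesis unfolding CP_u_robust[OF assms] unfolding g_lo_def k_def[symmetric]
    using assms(1) by (simp add: field_simps)
qed

lemma CP_o_robust:
  assumes "0 < m" "0 < rl" "0 < a" "p \<le> m"
  shows "CP_o m rl rh p a 0 = min a (m - p) / min a m"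
  using assms
  by (simp add: CP_o_def clairvoyant_def ratio_to_opt_def max_def min_def)

text \<open>\<open>R \<le> CP_o\<close> means that \<open>R * min a m\<close> is at most
  \<open>a\<close> and at most \<open>m - p\<close>. The former follows from
  \<open>R \<le> 1\<close>, the latter is the bound \<open>g_hi\<close>.\<close>

lemma le_g_hi_iff:
  assumes "0 < m" "0 < rl" "0 < a" "0 \<le> p" "p \<le> m" "R \<le> 1"
  shows "p \<le> g_hi m R a \<longleftrightarrow> R \<le> CP_o m rl rh p a 0"
proof -
  have pos: "0 < min a m" using assms by simp
  have "R * min a m \<le> 1 * min a m" using assms(6) pos by (intro mult_right_mono) auto
  then show ?thesis
    unfolding CP_o_robust[OF assms(1-3,5)] g_hi_def pos_le_divide_eq[OF pos] by auto
qed

text \<open>A ratio below 1 excludes the flat part of \<open>CP_o\<close>, on which the level cannot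
  be recovered from the ratio.\<close>

lemma g_hi_CP_o:
  assumes "0 < m" "0 < rl" "0 < a" "0 \<le> p" "p \<le> m" "CP_o m rl rh p a 0 < 1"
  shows "g_hi m (CP_o m rl rh p a 0) a = p"
proof -
  have pos: "0 < min a m" using assms by simp
  have "min a (m - p) < min a m"
    using assms(6) pos by (simp add: CP_o_robust[OF assms(1-3,5)] divide_less_eq_1)
  then have "min a (m - p) = m - p" by auto
  then show ?thesis
    unfolding CP_o_robust[OF assms(1-3,5)] g_hi_def using pos by (simp del: min_less_iff_conj)
qed

lemma CP_o_g_hi:
  assumes "0 < m" "0 < rl" "0 < a" "0 \<le> R" "R \<le> 1"
  shows "CP_o m rl rh (g_hi m R a) a 0 = R"
proof -
  have pos: "0 < min a m" using assms by simp
  have "R * min a m \<le> 1 * min a m" using assms(5) pos by (intro mult_right_mono) auto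
  moreover have "0 \<le> R * min a m" using assms(4) pos by (intro mult_nonneg_nonneg) auto
  ultimately have "g_hi m R a \<le> m" "min a (m - g_hi m R a) = R * min a m"
    by (auto simp: g_hi_def)
  then show ?thesis
    using CP_o_robust[OF assms(1-3), of "g_hi m R a" rh] pos by simp
qed

section \<open>Feasibility of truncated affine functions\<close>

lemma max_affine_derivative:
  fixes \<alpha> \<beta> g :: real
  assumes "0 \<le> \<beta>" "\<beta> \<le> 1" "x \<noteq> (\<alpha> - g) / \<beta>"
  shows "\<exists>d. ((\<lambda>x. max (\<alpha> - \<beta> * x) g) has_real_derivative d) (at x) \<and> -1 \<le> d \<and> d \<le> 0"
proof -
  \<comment> \<open>The excluded point is the kink. For \<open>\<beta> = 0\<close> the function is
    constant and the quotient is 0 by convention, which excludes one harmless point.\<close>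
  consider "\<beta> = 0" | "\<alpha> - \<beta> * x < g" | "g < \<alpha> - \<beta> * x" | "\<beta> > 0" "\<alpha> - \<beta> * x = g"
    using assms(1) by linarith
  then show ?thesis
  proof cases
    case 1
    then show ?thesis by (intro exI[of _ 0]) auto
  next
    case 2
    have "open {x. \<alpha> - \<beta> * x < g}" by (intro open_Collect_less continuous_intros)
    then have "((\<lambda>x. max (\<alpha> - \<beta> * x) g) has_real_derivative 0) (at x)"
      using 2 by (intro has_field_derivative_transform_within_open[OF DERIV_const]) auto
    then show ?thesis by (intro exI[of _ 0]) auto
  next
    case 3
    have "open {x. g < \<alpha> - \<beta> * x}" by (intro open_Collect_less continuous_intros)
    moreover have "((\<lambda>x. \<alpha> - \<beta> * x) has_real_derivative - \<beta>) (at x)"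
      by (auto intro!: derivative_eq_intros)
    ultimately have "((\<lambda>x. max (\<alpha> - \<beta> * x) g) has_real_derivative - \<beta>) (at x)"
      using 3 by (auto intro: has_field_derivative_transform_within_open)
    then show ?thesis using assms by (intro exI[of _ "- \<beta>"]) auto
  next
    case 4
    then show ?thesis using assms(3) by (simp add: field_simps)
  qed
qed

text \<open>On the interval every branch of \<open>p_right\<close> has this shape, so feasibility is
  checked once for all; the kink is a null set.\<close>

lemma right_feasible_max_affine:
  assumes "0 \<le> R" "R \<le> \<rho> rl rh"
    and "l_tilde m rl rh \<R> H C (x_hi \<R>) \<le> p (x_hi \<R>)" "p (x_hi \<R>) \<le> u_bound m rl rh \<R> L C (x_hi \<R>)"
    and g: "\<And>x. x \<in> {x_hi \<R>..max m (x_hi \<R>)} \<Longrightarrow> g_lo m rl rh R x \<le> p x \<and> p x \<le> g_hi m R x \<and> 0 \<le> p x"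
    and p: "\<And>x. x \<in> {x_hi \<R>..max m (x_hi \<R>)} \<Longrightarrow> p x = max (\<alpha> - \<beta> * x) \<gamma>"
    and \<beta>: "0 \<le> \<beta>" "\<beta> \<le> 1"
  shows "right_feasible m rl rh \<R> L H C R p"
proof -
  let ?I = "{x_hi \<R>..max m (x_hi \<R>)}"
  have "continuous_on ?I (\<lambda>x. max (\<alpha> - \<beta> * x) \<gamma>)" by (intro continuous_intros)
  then have "continuous_on ?I p" by (rule continuous_on_eq) (use p in auto)
  moreover have "\<exists>d. (p has_real_derivative d) (at x within ?I) \<and> -1 \<le> d \<and> d \<le> 0"
    if x: "x \<in> ?I" "x \<noteq> (\<alpha> - \<gamma>) / \<beta>" for x
  proof -
    obtain d where d: "((\<lambda>x. max (\<alpha> - \<beta> * x) \<gamma>) has_real_derivative d) (at x)" "-1 \<le> d" "d \<le> 0"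
      using max_affine_derivative[OF \<beta> x(2)] by auto
    have "(p has_real_derivative d) (at x within ?I)"
      using has_field_derivative_at_within[OF d(1)]
      by (rule has_field_derivative_transform_within[where d = 1]) (use x(1) p in auto)
    then show ?thesis using d by auto
  qed
  then have "AE x in lborel. x \<in> ?I \<longrightarrow>
      (\<exists>d. (p has_real_derivative d) (at x within ?I) \<and> -1 \<le> d \<and> d \<le> 0)"
    using AE_lborel_singleton[of "(\<alpha> - \<gamma>) / \<beta>"] by (auto elim!: eventually_mono)
  ultimately show ?thesis
    using assms(1-4) g unfolding right_feasible_def Let_def by blast
qed

lemma right_feasible_bounds:
  assumes "right_feasible m rl rh \<R> L H C R p"
  shows "0 \<le> R" "R \<le> \<rho> rl rh"
    "l_tilde m rl rh \<R> H C (x_hi \<R>) \<le> p (x_hi \<R>)" "p (x_hi \<R>) \<le> u_bound m rl rh \<R> L C (x_hi \<R>)"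
    "g_lo m rl rh R (x_hi \<R>) \<le> p (x_hi \<R>)" "p (x_hi \<R>) \<le> g_hi m R (x_hi \<R>)"
  using assms by (auto simp: right_feasible_def Let_def)

lemma right_value_eq:
  assumes "right_optimal m rl rh \<R> L H C R p"
  shows "right_value m rl rh \<R> L H C = R"
  unfolding right_value_def
  using assms by (intro cSup_eq_maximum) (auto simp: right_optimal_def)

text \<open>Strictly between the two robustness bounds both ratios in \<open>R_right\<close> exceed
  \<open>\<rho>\<close>, the largest admissible value; elsewhere the last conjunct gives the bare
  formula.\<close>

theorem theorem4:
  fixes m rl rh C :: real and \<R> :: "(real \<times> real) set" and L H :: "real \<times> real"
  assumes "m > 0" and "0 < rl" and "rl < rh"
    and "convex \<R>" and "\<And>x y. (x, y) \<in> \<R> \<Longrightarrow> 0 \<le> x \<and> 0 \<le> y"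
    and "bounded \<R>" and "closed (fst ` \<R>)"
    and "is_L m \<R> L" and "is_H m \<R> H"
    and "0 \<le> C" and "C \<le> C_star m rl rh \<R>"
  shows "right_optimal m rl rh \<R> L H C (min (\<rho> rl rh) (R_right m rl rh \<R> L H C))
           (p_right m rl rh \<R> L H C)
       \<and> right_value m rl rh \<R> L H C = min (\<rho> rl rh) (R_right m rl rh \<R> L H C)
       \<and> (p_right m rl rh \<R> L H C (x_hi \<R>)
            \<notin> {g_lo m rl rh (\<rho> rl rh) (x_hi \<R>)<..<g_hi m (\<rho> rl rh) (x_hi \<R>)}
          \<longrightarrow> right_value m rl rh \<R> L H C = R_right m rl rh \<R> L H C)"
proof -
  define a where "a = x_hi \<R>"
  define M where "M = max m a"
  define l where "l = l_tilde m rl rh \<R> H C a"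
  define u where "u = u_bound m rl rh \<R> L C a"
  define r where "r = \<rho> rl rh"
  define g where "g = m * (1 - r)"
  define p0 where "p0 = p_right_start m rl rh \<R> L H C"
  define R where "R = R_right m rl rh \<R> L H C"
  have LH: "L \<in> \<R>" "H \<in> \<R>"
    using assms(8,9) by (auto simp: is_L_def is_H_def region_bot_def region_top_def)
  have lu: "0 \<le> l" "l \<le> u" "u \<le> m"
    using protection_interval[OF assms(1-7) LH assms(11)] by (auto simp: l_def u_def a_def)
  \<comment> \<open>For \<open>a = 0\<close> the ratio \<open>CP_o\<close> is 1 by convention and
    cannot limit \<open>R\<close>; \<open>l = 0\<close> then keeps the start value at or below
    \<open>g\<close>.\<close>
  have l0: "l = 0" if "a = 0"
    using l_tilde_x_hi_eq_0[OF assms(1-7) LH(2) assms(11)] that by (simp add: l_def a_def)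
  have a: "0 \<le> a"
    using fst_image_Icc(1)[OF assms(4,6,7) LH(2)] assms(5)[of "fst H" "snd H"] LH(2)
    by (simp add: a_def)
  have r: "0 < r" "r < 1" using \<rho>_bounds[OF assms(2,3)] by (auto simp: r_def)
  have g_lo: "g_lo m rl rh r x = g" for x
    using g_lo_\<rho>[OF assms(2,3)] by (simp add: r_def g_def)
  have g: "0 < g" "g < m" using r assms(1) by (auto simp: g_def)
  have g_hi: "g \<le> g_hi m r x" for x
    using r assms(1) by (simp add: g_def g_hi_def algebra_simps)
  have p0: "p0 = max l (min u g)"
    using arg_min_dist_Icc[OF lu(2), of g] g_lo[of a]
    by (simp add: p0_def p_right_start_def l_def u_def r_def a_def)
  have p0m: "0 \<le> p0" "p0 \<le> m" "l \<le> p0" "p0 \<le> u" using p0 lu g by auto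
  have M: "m \<le> M" "a \<le> M" by (auto simp: M_def)
  define Ro where "Ro = CP_o m rl rh p0 a 0"
  define Ru where "Ru = CP_u m rl rh p0 M m"
  have R: "R = min Ro Ru"
    by (simp add: R_def R_right_def Ro_def Ru_def p0_def a_def M_def)
  note U = g_lo_le_iff[OF assms(1-3) M(1)]
  note O = le_g_hi_iff[OF assms(1,2)]
  have Ro_ge: "r \<le> Ro" if "p0 \<le> g_hi m r a"
  proof (cases "a = 0")
    case True
    then show ?thesis using r assms(1) by (simp add: Ro_def CP_o_def clairvoyant_def ratio_to_opt_def)
  next
    case False
    then show ?thesis using O[of a p0 r] that p0m a r by (simp add: Ro_def)
  qed
  have Ru_ge: "r \<le> Ru" if "g \<le> p0"
    using U[OF p0m(1), of r] that g_lo by (simp add: Ru_def)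
  have p_right_a: "p_right m rl rh \<R> L H C a = p0"
    by (simp add: p_right_def a_def p0_def)
  have p_right: "p_right m rl rh \<R> L H C x =
      (if p0 < g then g_lo m rl rh R x else if p0 > g_hi m r a then g_hi m R x else max (- x + a + p0) g)"
    if "a < x" for x
    using that g_lo unfolding p_right_def Let_def
    by (simp add: a_def[symmetric] p0_def[symmetric] R_def[symmetric] r_def[symmetric])
  have feasibleI: "right_feasible m rl rh \<R> L H C R' (p_right m rl rh \<R> L H C)"
    if "0 \<le> R'" "R' \<le> r" "\<And>x. x \<in> {a..M} \<Longrightarrow> p_right m rl rh \<R> L H C x = max (\<alpha> - \<beta> * x) \<gamma>"
      "\<And>x. x \<in> {a..M} \<Longrightarrow> g_lo m rl rh R' x \<le> max (\<alpha> - \<beta> * x) \<gamma> \<and> max (\<alpha> - \<beta> * x) \<gamma> \<le> g_hi m R' x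
        \<and> 0 \<le> max (\<alpha> - \<beta> * x) \<gamma>" "0 \<le> \<beta>" "\<beta> \<le> 1" for R' \<alpha> \<beta> \<gamma>
    using that p_right_a p0m(3,4)
    by (intro right_feasible_max_affine[where \<alpha> = \<alpha> and \<beta> = \<beta> and \<gamma> = \<gamma>])
      (auto simp: a_def[symmetric] M_def[symmetric] r_def[symmetric] l_def[symmetric] u_def[symmetric])
  have g_hi_anti: "g_hi m r x \<le> g_hi m R' x" if "R' \<le> r" "0 \<le> x" for R' x
    using that assms(1) by (auto simp: g_hi_def intro!: mult_right_mono)
  have "right_feasible m rl rh \<R> L H C (min r R) (p_right m rl rh \<R> L H C) \<and>
    (\<forall>R' p'. right_feasible m rl rh \<R> L H C R' p' \<longrightarrow> R' \<le> min r R) \<and>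
    (p0 \<notin> {g<..<g_hi m r a} \<longrightarrow> R \<le> r)"
  proof -
    consider "p0 < g" | "g \<le> p0" "p0 \<le> g_hi m r a" | "g_hi m r a < p0" by linarith
    then show ?thesis
    proof cases
      case 1
      \<comment> \<open>The projection of \<open>g\<close> lies below \<open>g\<close> only at the
        upper end \<open>u\<close>; every feasible start is then at most \<open>p0\<close>, and its
        lower robustness bound forces \<open>R' \<le> Ru\<close>.\<close>
      then have u: "p0 = u" using p0 lu by auto
      have "Ru < r" using U[OF p0m(1), of r] 1 g_lo by (simp add: Ru_def)
      moreover have "r \<le> Ro" using 1 g_hi[of a] by (intro Ro_ge) simp
      ultimately have RR: "R = Ru" "R < r" by (auto simp: R)
      have g_lo_R: "g_lo m rl rh R x = p0" for x
        unfolding RR Ru_def by (rule g_lo_CP_u[OF assms(1-3) M(1) p0m(1)])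
      have "0 \<le> R" unfolding RR Ru_def CP_u_robust[OF assms(1-3) M(1) p0m(1)]
        using assms(1-3) p0m by (intro add_nonneg_nonneg mult_nonneg_nonneg) auto
      moreover have "p_right m rl rh \<R> L H C x = p0" if "x \<in> {a..M}" for x
        using that p_right_a p_right[of x] 1 g_lo_R by (cases "x = a") auto
      moreover have "p0 \<le> g_hi m R x" if "x \<in> {a..M}" for x
        using g_hi[of x] g_hi_anti[of R x] 1 RR that a by auto
      ultimately have "right_feasible m rl rh \<R> L H C R (p_right m rl rh \<R> L H C)"
        using RR p0m g_lo_R by (intro feasibleI[where \<alpha> = p0 and \<beta> = 0 and \<gamma> = p0]) auto
      moreover have "R' \<le> R" if "right_feasible m rl rh \<R> L H C R' p'" for R' p'
        using right_feasible_bounds(4,5)[OF that] U[OF p0m(1), of R' a] u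
        by (simp add: RR Ru_def a_def u_def)
      ultimately show ?thesis using RR by (auto simp: min_absorb2)
    next
      case 2
      then have RR: "r \<le> R" using Ro_ge Ru_ge by (simp add: R)
      have "p_right m rl rh \<R> L H C x = max (a + p0 - x) g" if "x \<in> {a..M}" for x
        using that p_right_a p_right[of x] 2 by (cases "x = a") (auto simp: algebra_simps)
      \<comment> \<open>The descent with slope -1 starts at or below \<open>g_hi\<close> and is
        steeper than its slope \<open>- r\<close>; points \<open>x > a\<close> of the interval
        satisfy \<open>x \<le> m\<close>, where \<open>g_hi\<close> is not yet flat.\<close>
      moreover have "a + p0 - x \<le> g_hi m r x" if "x \<in> {a..M}" for x
      proof (cases "x = a")
        case False
        then have "x \<le> m" "a < x" using that by (auto simp: M_def split: if_splits)
        moreover have "r * (x - a) \<le> x - a"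
          using r \<open>a < x\<close> by (simp add: mult_le_cancel_right1)
        ultimately show ?thesis using 2 by (simp add: g_hi_def algebra_simps)
      qed (use 2 in simp)
      ultimately have feas: "right_feasible m rl rh \<R> L H C r (p_right m rl rh \<R> L H C)"
        using r g g_lo g_hi by (intro feasibleI[where \<alpha> = "a + p0" and \<beta> = 1 and \<gamma> = g]) auto
      \<comment> \<open>At an end of the robust range the corresponding ratio equals
        \<open>r\<close>, by inverting the bound met there.\<close>
      have "R \<le> r" if "p0 \<notin> {g<..<g_hi m r a}"
      proof (cases "p0 = g")
        case True
        then have "Ru = r"
          using CP_u_g_lo[OF assms(1-3) M(1), of r a] g_lo g by (simp add: Ru_def)
        then show ?thesis by (simp add: R)
      next
        case False
        then have eq: "p0 = g_hi m r a" using that 2 by auto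
        have "a \<noteq> 0"
        proof
          assume "a = 0"
          then have "p0 = m" using eq assms(1) by (simp add: g_hi_def)
          then show False using p0 l0[OF \<open>a = 0\<close>] g by auto
        qed
        then have "Ro = r"
          using CP_o_g_hi[OF assms(1,2), of a r rh] a r by (simp add: Ro_def eq)
        then show ?thesis by (simp add: R)
      qed
      moreover have "R' \<le> r" if "right_feasible m rl rh \<R> L H C R' p'" for R' p'
        using right_feasible_bounds(2)[OF that] by (simp add: r_def)
      ultimately show ?thesis using feas RR by (auto simp: min_absorb1)
    next
      case 3
      then have gp: "g < p0" using g_hi[of a] by simp
      \<comment> \<open>Symmetrically, the projection is the lower end \<open>l\<close>, every
        feasible start is at least \<open>p0\<close>, and its upper robustness bound forces
        \<open>R' \<le> Ro\<close>.\<close>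
      then have l: "p0 = l" using p0 by auto
      have a0: "0 < a" using a 3 p0m(2) assms(1) by (cases "a = 0") (auto simp: g_hi_def)
      have "Ro < r" using O[OF a0 p0m(1,2), of r rh] 3 r by (simp add: Ro_def)
      moreover have "r \<le> Ru" using gp by (intro Ru_ge) simp
      ultimately have RR: "R = Ro" "R < r" by (auto simp: R)
      have g_hi_a: "g_hi m R a = p0"
        unfolding RR Ro_def using RR r
        by (intro g_hi_CP_o[OF assms(1,2) a0 p0m(1,2)]) (simp add: Ro_def)
      have R0: "0 \<le> R" unfolding RR Ro_def CP_o_robust[OF assms(1,2) a0 p0m(2)]
        using a0 assms(1) p0m by simp
      have g_le: "g \<le> g_hi m R x" if "x \<in> {a..M}" for x
        using g_hi[of x] g_hi_anti[of R x] RR that a by auto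
      have "p_right m rl rh \<R> L H C x = g_hi m R x" if "x \<in> {a..M}" for x
        using that p_right_a p_right[of x] 3 gp g_hi_a by (cases "x = a") auto
      \<comment> \<open>If \<open>a < m\<close>, the interval is \<open>{a..m}\<close>, where
        \<open>g_hi m R\<close> is \<open>m - R * x\<close>; otherwise it is the single point
        \<open>a\<close>, described by a constant. The maximum with \<open>g\<close> changes
        nothing, as \<open>g_hi m R\<close> stays above \<open>g\<close>.\<close>
      moreover define \<beta> \<alpha> where "\<beta> = (if a < m then R else 0)" and "\<alpha> = (if a < m then m else p0)"
      have "g_hi m R x = max (\<alpha> - \<beta> * x) g" if "x \<in> {a..M}" for x
      proof (cases "a < m")
        case True
        then show ?thesis using that g_le[OF that] by (simp add: \<alpha>_def \<beta>_def g_hi_def M_def)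
      next
        case False
        then have "x = a" using that by (simp add: M_def)
        then show ?thesis using g_hi_a gp False by (simp add: \<alpha>_def \<beta>_def)
      qed
      moreover have "g_lo m rl rh R x \<le> g" for x
        using U[of g R x] U[of g r x] g g_lo RR by simp
      ultimately have "right_feasible m rl rh \<R> L H C R (p_right m rl rh \<R> L H C)"
        using RR R0 r g g_le
        by (intro feasibleI[where \<alpha> = \<alpha> and \<beta> = \<beta> and \<gamma> = g]) (auto simp: \<beta>_def le_max_iff_disj)
      moreover have "R' \<le> R" if "right_feasible m rl rh \<R> L H C R' p'" for R' p'
        using right_feasible_bounds(2,3,6)[OF that] O[OF a0 p0m(1,2), of R' rh] l r
        by (simp add: RR Ro_def a_def l_def r_def)
      ultimately show ?thesis using RR by (auto simp: min_absorb2)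
    qed
  qed
  then have opt: "right_optimal m rl rh \<R> L H C (min r R) (p_right m rl rh \<R> L H C)"
    and le: "p0 \<notin> {g<..<g_hi m r a} \<longrightarrow> R \<le> r"
    by (auto simp: right_optimal_def)
  show ?thesis
    using opt right_value_eq[OF opt] le
    unfolding a_def[symmetric] p_right_a r_def[symmetric] R_def[symmetric] g_lo
    by (auto simp: min_absorb2)
qed

end
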